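(* Let $1\le k<n-1$. The degenerate locus for $G(k,n)$ is the set of complex $n\times n$ matrices $B$ satisfying $$\det\Big(\wedge^kI+\sum_{j=0}^{k-1}(\wedge^jI)\wedge B\wedge(\wedge^{k-1-j}I)\Big)=0 .$$
   Context: $V=\mathbb C^n$, $G(k,n)$ is the Grassmannian of $k$-planes in $V$, $\mathcal S$ the tautological subbundle, $\mathcal V$ the trivial bundle with fibre $V$. For an $n\times n$ matrix $B$ (acting on $V$), $f_B:\mathcal V^*\otimes\mathcal S\to\mathcal S^*\otimes\mathcal S$ is the bundle map $f_B(\xi\otimes s)=\xi|_{\mathcal S}\otimes s+\xi(Bs)\,\mathrm{id}_{\mathcal S}$. The degenerate locus for $G(k,n)$ is the set of $B$ for which $f_B$ fails to be surjective on the fibre at some point of $G(k,n)$. The operator $(\wedge^jI)\wedge B\wedge(\wedge^{k-1-j}I)$ is understood in the sum as acting on $\wedge^kV$ by applying $B$ to the $(j+1)$-st factor: the operator in the determinant sends $u_1\wedge\dots\wedge u_k$ to $u_1\wedge\dots\wedge u_k+\sum_{j=1}^{k}u_1\wedge\dots\wedge Bu_j\wedge\dots\wedge u_k$. *)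

theory Defs
  imports Complex_Main "Jordan_Normal_Form.Determinant" "Jordan_Normal_Form.VS_Connect"
begin

section \<open>The Grassmannian and the bundle map\<close>

text \<open>
  \<open>V\<close> is \<open>carrier_vec n\<close> with its module structure \<open>module_vec TYPE(complex) n\<close>. A point of
  \<open>G(k,n)\<close> is a subspace \<open>W\<close>, which is also the fibre of the tautological subbundle there.
\<close>

abbreviation sub_vs :: "nat \<Rightarrow> complex vec set \<Rightarrow> (complex, complex vec) module" where
  "sub_vs n W \<equiv> module_vec TYPE(complex) n\<lparr>carrier := W\<rparr>"

definition grassmannian :: "nat \<Rightarrow> nat \<Rightarrow> complex vec set set" where
  "grassmannian k n =
     {W. subspace class_ring W (module_vec TYPE(complex) n) \<and>
         vectorspace.dim class_ring (sub_vs n W) = k}"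

text \<open>
  \<open>U\<^sup>* \<otimes> W\<close> is identified with the space of linear maps from \<open>U\<close> to \<open>W\<close>, the pure tensor
  \<open>\<xi> \<otimes> s\<close> being \<open>v \<mapsto> \<xi>(v) s\<close>; under this identification \<open>id\<^sub>W\<close> is an element of \<open>W\<^sup>* \<otimes> W\<close>.
  A covector \<open>\<xi>\<close> of \<open>V\<close> is given by its coordinates in the dual basis: \<open>\<xi>(v) = \<xi> \<bullet> v\<close>.
  Linear maps are extended by \<open>undefined\<close> outside their domain, so that equality of functions is
  equality of linear maps.
\<close>

definition hom_space ::
  "nat \<Rightarrow> complex vec set \<Rightarrow> complex vec set \<Rightarrow> (complex vec \<Rightarrow> complex vec) set" where
  "hom_space n U W = LinearCombinations.module_hom class_ring (sub_vs n U) (sub_vs n W) \<inter> extensional U"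

definition pure_tensor ::
  "complex vec set \<Rightarrow> complex vec \<Rightarrow> complex vec \<Rightarrow> complex vec \<Rightarrow> complex vec" where
  "pure_tensor U \<xi> s = (\<lambda>v\<in>U. (\<xi> \<bullet> v) \<cdot>\<^sub>v s)"

text \<open>\<open>f\<^sub>B(\<xi> \<otimes> s) = \<xi>|\<^sub>W \<otimes> s + \<xi>(Bs) id\<^sub>W\<close> in the fibre at \<open>W\<close>.\<close>

definition f_pure ::
  "complex mat \<Rightarrow> complex vec set \<Rightarrow> complex vec \<Rightarrow> complex vec \<Rightarrow> complex vec \<Rightarrow> complex vec" where
  "f_pure B W \<xi> s = (\<lambda>w\<in>W. pure_tensor W \<xi> s w + (\<xi> \<bullet> (B *\<^sub>v s)) \<cdot>\<^sub>v w)"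

text \<open>
  The linear extension to all of \<open>V\<^sup>* \<otimes> W\<close>, using \<open>T = (\<Sum>j<n. e\<^sub>j\<^sup>* \<otimes> T e\<^sub>j)\<close>. By
  \<open>f_map_pure_tensor\<close> and \<open>f_map_eq\<close> below it agrees with \<open>f_pure\<close> on every pure tensor, and is
  linear.
\<close>

definition f_map ::
  "nat \<Rightarrow> complex mat \<Rightarrow> complex vec set \<Rightarrow> (complex vec \<Rightarrow> complex vec) \<Rightarrow> complex vec \<Rightarrow> complex vec"
  where
  "f_map n B W T =
     (\<lambda>w\<in>W. finsum_vec TYPE(complex) n
        (\<lambda>j. f_pure B W (unit_vec n j) (T (unit_vec n j)) w) {..<n})"

definition degenerate_locus :: "nat \<Rightarrow> nat \<Rightarrow> complex mat set" where
  "degenerate_locus k n =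
     {B \<in> carrier_mat n n. \<exists>W \<in> grassmannian k n.
        \<not> hom_space n W W \<subseteq> f_map n B W ` hom_space n (carrier_vec n) W}"

section \<open>Exterior powers\<close>

text \<open>
  \<open>\<Lambda>\<^sup>k V\<close> is modelled as the space with the standard basis \<open>e\<^sub>I\<close>, where \<open>I\<close> runs through the
  strictly increasing index lists of length \<open>k\<close>. The \<open>I\<close>-coordinate of \<open>u\<^sub>1 \<and> \<dots> \<and> u\<^sub>k\<close> is the
  minor of the matrix \<open>(u\<^sub>1, \<dots>, u\<^sub>k)\<close> that belongs to \<open>I\<close>.
\<close>

definition index_lists :: "nat \<Rightarrow> nat \<Rightarrow> nat list list" where
  "index_lists k n = filter (\<lambda>I. length I = k) (subseqs [0..<n])"

definition wedge :: "nat \<Rightarrow> complex vec list \<Rightarrow> complex vec" where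
  "wedge n us = (let k = length us in
     vec_of_list (map (\<lambda>I. det (mat k k (\<lambda>(i, j). us ! i $ (I ! j)))) (index_lists k n)))"

definition wedge_action :: "nat \<Rightarrow> complex mat \<Rightarrow> complex vec list \<Rightarrow> complex vec" where
  "wedge_action n B us =
     wedge n us +
     finsum_vec TYPE(complex) (length (index_lists (length us) n))
       (\<lambda>j. wedge n (us[j := B *\<^sub>v us ! j])) {..<length us}"

text \<open>
  The matrix, in the basis \<open>e\<^sub>I\<close>, of the operator on \<open>\<Lambda>\<^sup>k V\<close> that sends \<open>u\<^sub>1 \<and> \<dots> \<and> u\<^sub>k\<close> to
  \<open>u\<^sub>1 \<and> \<dots> \<and> u\<^sub>k + (\<Sum>j. u\<^sub>1 \<and> \<dots> \<and> B u\<^sub>j \<and> \<dots> \<and> u\<^sub>k)\<close>. Its columns are the values of the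
  operator at the basis vectors; \<open>wedge_op_wedge\<close> below shows that it acts by this formula on all
  wedge products.
\<close>

definition wedge_op :: "nat \<Rightarrow> nat \<Rightarrow> complex mat \<Rightarrow> complex mat" where
  "wedge_op k n B =
     mat_of_cols (length (index_lists k n))
       (map (\<lambda>I. wedge_action n B (map (unit_vec n) I)) (index_lists k n))"

section \<open>The bundle map on pure tensors\<close>

lemma hom_spaceD:
  assumes "T \<in> hom_space n U W"
  shows "v \<in> U \<Longrightarrow> T v \<in> W"
    and "u \<in> U \<Longrightarrow> v \<in> U \<Longrightarrow> T (u + v) = T u + T v"
    and "v \<in> U \<Longrightarrow> T (c \<cdot>\<^sub>v v) = c \<cdot>\<^sub>v T v"
  using assms by (auto simp: hom_space_def LinearCombinations.module_hom_def module_vec_simps)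

lemma hom_space_index:
  assumes T: "T \<in> hom_space n (carrier_vec n) W" and W: "W \<subseteq> carrier_vec n"
    and w: "w \<in> carrier_vec n" and i: "i < n"
  shows "T w $ i = (\<Sum>j<n. w $ j * T (unit_vec n j) $ i)"
proof -
  have TC: "T v \<in> carrier_vec n" if "v \<in> carrier_vec n" for v
    using hom_spaceD(1)[OF T that] W by auto
  define p where "p m = vec n (\<lambda>j. if j < m then w $ j else 0)" for m
  have pC: "p m \<in> carrier_vec n" for m by (simp add: p_def)
  have "T (p m) $ i = (\<Sum>j<m. w $ j * T (unit_vec n j) $ i)" if "m \<le> n" for m
    using that
  proof (induction m)
    case 0
    have "p 0 = 0 \<cdot>\<^sub>v 0\<^sub>v n" by (auto simp: p_def)
    then have "T (p 0) = 0 \<cdot>\<^sub>v T (0\<^sub>v n)" using hom_spaceD(3)[OF T] by simp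
    then show ?case using TC[of "0\<^sub>v n"] i by auto
  next
    case (Suc m)
    have "p (Suc m) = p m + w $ m \<cdot>\<^sub>v unit_vec n m"
      using Suc.prems by (intro eq_vecI) (auto simp: p_def unit_vec_def less_Suc_eq)
    then have "T (p (Suc m)) = T (p m) + w $ m \<cdot>\<^sub>v T (unit_vec n m)"
      using hom_spaceD(2)[OF T pC[of m], of "w $ m \<cdot>\<^sub>v unit_vec n m"]
        hom_spaceD(3)[OF T, of "unit_vec n m"] by simp
    then show ?case using Suc TC[OF pC[of m]] TC[of "unit_vec n m"] i by auto
  qed
  moreover have "p n = w" using w by (auto simp: p_def)
  ultimately show ?thesis by force
qed

lemma f_map_eq:
  assumes T: "T \<in> hom_space n (carrier_vec n) W" and W: "W \<subseteq> carrier_vec n"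
    and B: "B \<in> carrier_mat n n" and w: "w \<in> W"
  shows "f_map n B W T w = T w + (\<Sum>j<n. (B *\<^sub>v T (unit_vec n j)) $ j) \<cdot>\<^sub>v w"
proof -
  have wC: "w \<in> carrier_vec n" using w W by auto
  have TC: "T v \<in> carrier_vec n" if "v \<in> carrier_vec n" for v
    using hom_spaceD(1)[OF T that] W by auto
  have dimT: "dim_vec (T (unit_vec n j)) = n" for j using TC[of "unit_vec n j"] by auto
  have dimT': "dim_vec (T w) = n" using TC[OF wC] by auto
  have fC: "f_pure B W (unit_vec n j) (T (unit_vec n j)) w \<in> carrier_vec n" for j
    using w carrier_vecD[OF wC] by (intro carrier_vecI) (simp add: f_pure_def pure_tensor_def)
  have f_idx: "f_pure B W (unit_vec n j) (T (unit_vec n j)) w $ i =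
     w $ j * T (unit_vec n j) $ i + (B *\<^sub>v T (unit_vec n j)) $ j * w $ i"
    if "i < n" "j < n" for i j
    using that w wC dimT[of j] mult_mat_vec_carrier[OF B TC[of "unit_vec n j"]]
    by (auto simp: f_pure_def pure_tensor_def simp del: index_mult_mat_vec)
  have sumC: "finsum_vec TYPE(complex) n
      (\<lambda>j. f_pure B W (unit_vec n j) (T (unit_vec n j)) w) {..<n} \<in> carrier_vec n"
    using fC by (intro finsum_vec_closed) auto
  show ?thesis
  proof (rule eq_vecI)
    fix i assume "i < dim_vec (T w + (\<Sum>j<n. (B *\<^sub>v T (unit_vec n j)) $ j) \<cdot>\<^sub>v w)"
    then have i: "i < n" using wC by auto
    have "f_map n B W T w $ i =
        (\<Sum>j<n. f_pure B W (unit_vec n j) (T (unit_vec n j)) w $ i)"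
      using w i fC unfolding f_map_def by (simp add: index_finsum_vec)
    also have "\<dots> = (\<Sum>j<n. w $ j * T (unit_vec n j) $ i) +
        (\<Sum>j<n. (B *\<^sub>v T (unit_vec n j)) $ j) * w $ i"
      using f_idx[OF i] by (simp add: sum.distrib sum_distrib_right del: index_mult_mat_vec)
    also have "\<dots> = (T w + (\<Sum>j<n. (B *\<^sub>v T (unit_vec n j)) $ j) \<cdot>\<^sub>v w) $ i"
      using hom_space_index[OF T W wC i] wC dimT' i by (simp del: index_mult_mat_vec)
    finally show "f_map n B W T w $ i =
        (T w + (\<Sum>j<n. (B *\<^sub>v T (unit_vec n j)) $ j) \<cdot>\<^sub>v w) $ i" .
  next
    show "dim_vec (f_map n B W T w) =
        dim_vec (T w + (\<Sum>j<n. (B *\<^sub>v T (unit_vec n j)) $ j) \<cdot>\<^sub>v w)"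
      using w wC sumC by (auto simp: f_map_def)
  qed
qed

lemma subspace_closed:
  assumes "subspace class_ring W (module_vec TYPE(complex) n)"
  shows "W \<subseteq> carrier_vec n" "u \<in> W \<Longrightarrow> v \<in> W \<Longrightarrow> u + v \<in> W" "v \<in> W \<Longrightarrow> c \<cdot>\<^sub>v v \<in> W"
  using assms submodule.subset[of class_ring W "module_vec TYPE(complex) n"]
    submodule.m_closed[of class_ring W "module_vec TYPE(complex) n" u v]
    submodule.smult_closed[of class_ring W "module_vec TYPE(complex) n" c v]
  by (auto simp: subspace_def module_vec_simps)

lemma f_map_closed:
  assumes W: "subspace class_ring W (module_vec TYPE(complex) n)"
    and B: "B \<in> carrier_mat n n" and T: "T \<in> hom_space n (carrier_vec n) W"
  shows "f_map n B W T \<in> hom_space n W W"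
proof -
  note cl = subspace_closed[OF W]
  note eq = f_map_eq[OF T cl(1) B]
  define c where "c = (\<Sum>j<n. (B *\<^sub>v T (unit_vec n j)) $ j)"
  have TC: "T v \<in> carrier_vec n" if "v \<in> W" for v
    using hom_spaceD(1)[OF T, of v] that cl(1) by auto
  have "f_map n B W T \<in> W \<rightarrow> W"
    using hom_spaceD(1)[OF T] cl by (auto simp: eq subset_eq simp del: index_mult_mat_vec)
  moreover have "f_map n B W T (u + v) = f_map n B W T u + f_map n B W T v"
    if uv: "u \<in> W" "v \<in> W" for u v
  proof -
    have C: "u \<in> carrier_vec n" "v \<in> carrier_vec n" using uv cl(1) by auto
    show ?thesis
      unfolding eq[OF uv(1)] eq[OF uv(2)] eq[OF cl(2)[OF uv]] c_def[symmetric]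
        hom_spaceD(2)[OF T C]
      using TC[OF uv(1)] TC[OF uv(2)] C
      by (intro eq_vecI) (auto simp: algebra_simps)
  qed
  moreover have "f_map n B W T (r \<cdot>\<^sub>v v) = r \<cdot>\<^sub>v f_map n B W T v" if v: "v \<in> W" for r v
  proof -
    have C: "v \<in> carrier_vec n" using v cl(1) by auto
    show ?thesis
      unfolding eq[OF v] eq[OF cl(3)[OF v]] c_def[symmetric] hom_spaceD(3)[OF T C]
      using TC[OF v] C by (intro eq_vecI) (auto simp: algebra_simps)
  qed
  moreover have "f_map n B W T \<in> extensional W" by (simp add: f_map_def)
  ultimately show ?thesis by (simp add: hom_space_def LinearCombinations.module_hom_def module_vec_simps)
qed

lemma pure_tensor_hom:
  assumes W: "subspace class_ring W (module_vec TYPE(complex) n)"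
    and "\<xi> \<in> carrier_vec n" "s \<in> W"
  shows "pure_tensor (carrier_vec n) \<xi> s \<in> hom_space n (carrier_vec n) W"
  using assms(2,3) subspace_closed[OF W]
  by (auto simp: hom_space_def LinearCombinations.module_hom_def module_vec_simps pure_tensor_def
      scalar_prod_add_distrib[of _ n] add_smult_distrib_vec smult_smult_assoc)

lemma f_map_pure_tensor:
  assumes W: "subspace class_ring W (module_vec TYPE(complex) n)"
    and B: "B \<in> carrier_mat n n" and \<xi>: "\<xi> \<in> carrier_vec n" and s: "s \<in> W"
  shows "f_map n B W (pure_tensor (carrier_vec n) \<xi> s) = f_pure B W \<xi> s"
proof (rule extensionalityI[where A = W])
  fix w assume w: "w \<in> W"
  have C: "w \<in> carrier_vec n" "s \<in> carrier_vec n" using w s subspace_closed[OF W] by auto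
  have "(B *\<^sub>v pure_tensor (carrier_vec n) \<xi> s (unit_vec n j)) $ j = \<xi> $ j * (B *\<^sub>v s) $ j"
    if "j < n" for j
    using that \<xi> B C by (simp add: pure_tensor_def mult_mat_vec[OF B])
  then have "(\<Sum>j<n. (B *\<^sub>v pure_tensor (carrier_vec n) \<xi> s (unit_vec n j)) $ j) =
      \<xi> \<bullet> (B *\<^sub>v s)"
    using B by (simp add: scalar_prod_def atLeast0LessThan del: index_mult_mat_vec)
  then show "f_map n B W (pure_tensor (carrier_vec n) \<xi> s) w = f_pure B W \<xi> s w"
    using f_map_eq[OF pure_tensor_hom[OF W \<xi> s] subspace_closed(1)[OF W] B w] w C
    by (simp add: f_pure_def pure_tensor_def)
qed (auto simp: f_map_def f_pure_def)

section \<open>The operator on wedge products\<close>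

lemma sorted_subseqs:
  assumes "sorted_wrt (<) (xs :: nat list)" "ys \<in> set (subseqs xs)"
  shows "sorted_wrt (<) ys \<and> set ys \<subseteq> set xs"
  using assms
proof (induction xs arbitrary: ys)
  case (Cons x xs)
  then show ?case by (fastforce simp: Let_def)
qed auto

lemma set_index_lists:
  "I \<in> set (index_lists k n) \<longleftrightarrow> length I = k \<and> sorted_wrt (<) I \<and> set I \<subseteq> {..<n}"
proof
  assume "I \<in> set (index_lists k n)"
  then show "length I = k \<and> sorted_wrt (<) I \<and> set I \<subseteq> {..<n}"
    using sorted_subseqs[of "[0..<n]" I] by (auto simp: index_lists_def)
next
  assume *: "length I = k \<and> sorted_wrt (<) I \<and> set I \<subseteq> {..<n}"
  then have "set I \<in> set ` set (subseqs [0..<n])"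
    by (intro subset_subseqs) auto
  then obtain J where J: "J \<in> set (subseqs [0..<n])" "set J = set I" by auto
  then have "J = I" using sorted_subseqs[of "[0..<n]" J] * strict_sorted_equal by auto
  then show "I \<in> set (index_lists k n)" using J * by (auto simp: index_lists_def)
qed

lemma distinct_index_lists: "distinct (index_lists k n)"
  using distinct_set_subseqs[of "[0..<n]"] by (auto simp: index_lists_def distinct_map)

lemma wedge_carrier: "length us = k \<Longrightarrow> wedge n us \<in> carrier_vec (length (index_lists k n))"
  by (intro carrier_vecI) (auto simp: wedge_def Let_def)

lemma wedge_index:
  assumes "length us = k" "a < length (index_lists k n)"
  shows "wedge n us $ a = det (mat k k (\<lambda>(i, j). us ! i $ (index_lists k n ! a ! j)))"
  using assms by (simp add: wedge_def Let_def vec_of_list_index)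

lemma wedge_action_carrier:
  assumes "length us = k"
  shows "wedge_action n B us \<in> carrier_vec (length (index_lists k n))"
proof -
  have k: "k = length us" using assms by simp
  show ?thesis
    unfolding wedge_action_def k
    by (intro add_carrier_vec finsum_vec_closed) (auto intro!: wedge_carrier)
qed

lemma wedge_action_index:
  assumes "length us = k" "a < length (index_lists k n)"
  shows "wedge_action n B us $ a =
    wedge n us $ a + (\<Sum>j<k. wedge n (us[j := B *\<^sub>v us ! j]) $ a)"
proof -
  have 1: "wedge n (us[j := B *\<^sub>v us ! j]) \<in> carrier_vec (length (index_lists k n))" for j
    using assms by (intro wedge_carrier) simp
  have "finsum_vec TYPE(complex) (length (index_lists k n))
       (\<lambda>j. wedge n (us[j := B *\<^sub>v us ! j])) {..<k} \<in> carrier_vec (length (index_lists k n))"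
    using 1 by (intro finsum_vec_closed) auto
  then show ?thesis using assms 1 unfolding wedge_action_def by (simp add: index_finsum_vec)
qed

text \<open>Linearity in each slot is expressed by expansion in the standard basis.\<close>

definition alt_form :: "nat \<Rightarrow> nat \<Rightarrow> (complex vec list \<Rightarrow> complex) \<Rightarrow> bool" where
  "alt_form n k F \<longleftrightarrow>
     (\<forall>us j. length us = k \<longrightarrow> set us \<subseteq> carrier_vec n \<longrightarrow> j < k \<longrightarrow>
        F us = (\<Sum>m<n. us ! j $ m * F (us[j := unit_vec n m]))) \<and>
     (\<forall>us i j. length us = k \<longrightarrow> set us \<subseteq> carrier_vec n \<longrightarrow> i < k \<longrightarrow> j < k \<longrightarrow> i \<noteq> j \<longrightarrow>
        us ! i = us ! j \<longrightarrow> F us = 0)"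

lemma alt_formD:
  assumes "alt_form n k F" "length us = k" "set us \<subseteq> carrier_vec n"
  shows "j < k \<Longrightarrow> F us = (\<Sum>m<n. us ! j $ m * F (us[j := unit_vec n m]))"
    and "i < k \<Longrightarrow> j < k \<Longrightarrow> i \<noteq> j \<Longrightarrow> us ! i = us ! j \<Longrightarrow> F us = 0"
  using assms unfolding alt_form_def by blast+

lemma set_update: "set us \<subseteq> A \<Longrightarrow> x \<in> A \<Longrightarrow> set (us[j := x]) \<subseteq> A"
  by (meson insert_subset order_trans set_update_subset_insert)

lemma alt_form_slot:
  assumes F: "alt_form n k F" and us: "length us = k" "set us \<subseteq> carrier_vec n"
    and j: "j < k" and u: "u \<in> carrier_vec n"
  shows "F (us[j := u]) = (\<Sum>m<n. u $ m * F (us[j := unit_vec n m]))"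
  using alt_formD(1)[OF F, of "us[j := u]" j] us j u set_update[OF us(2) u] by simp

lemma alt_form_add:
  assumes F: "alt_form n k F" and us: "length us = k" "set us \<subseteq> carrier_vec n"
    and j: "j < k" and u: "u \<in> carrier_vec n" and v: "v \<in> carrier_vec n"
  shows "F (us[j := u + v]) = F (us[j := u]) + F (us[j := v])"
proof -
  have "u + v \<in> carrier_vec n" using u v by simp
  then show ?thesis
    unfolding alt_form_slot[OF F us j u] alt_form_slot[OF F us j v]
      alt_form_slot[OF F us j \<open>u + v \<in> carrier_vec n\<close>]
    using u v by (simp add: sum.distrib distrib_right)
qed

lemma alt_form_swap:
  assumes F: "alt_form n k F" and us: "length us = k" "set us \<subseteq> carrier_vec n"
    and ij: "i < k" "j < k" "i \<noteq> j" and u: "u \<in> carrier_vec n" and v: "v \<in> carrier_vec n"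
  shows "F (us[i := u, j := v]) = - F (us[i := v, j := u])"
proof -
  have uv: "u + v \<in> carrier_vec n" using u v by simp
  have z: "F (us[i := w, j := w]) = 0" if "w \<in> carrier_vec n" for w
    using alt_formD(2)[OF F, of "us[i := w, j := w]" i j] us ij that
      set_update[OF set_update[OF us(2) that] that] by simp
  have a1: "F (us[i := w, j := u + v]) = F (us[i := w, j := u]) + F (us[i := w, j := v])"
    if "w \<in> carrier_vec n" for w
    using alt_form_add[OF F, of "us[i := w]" j u v] us ij u v set_update[OF us(2) that] by simp
  have a2: "F (us[i := u + v, j := w]) = F (us[i := u, j := w]) + F (us[i := v, j := w])"
    if "w \<in> carrier_vec n" for w
    using alt_form_add[OF F, of "us[j := w]" i u v] us ij u v set_update[OF us(2) that]
    by (simp add: list_update_swap)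
  have "0 = F (us[i := u, j := u]) + F (us[i := u, j := v]) +
      (F (us[i := v, j := u]) + F (us[i := v, j := v]))"
    using z[OF uv] a2[OF uv] a1[OF u] a1[OF v] by simp
  then show ?thesis using z[OF u] z[OF v] by (simp add: eq_neg_iff_add_eq_0)
qed

lemma permute_list_transpose:
  assumes "a < length xs" "b < length xs"
  shows "permute_list (Transposition.transpose a b) xs = xs[a := xs ! b, b := xs ! a]"
  using assms
  by (intro nth_equalityI)
    (auto simp: permute_list_def nth_list_update Transposition.transpose_def)

lemma alt_form_permute:
  assumes F: "alt_form n k F" and p: "p permutes {..<k}"
    and us: "length us = k" "set us \<subseteq> carrier_vec n" and z: "F us = 0"
  shows "F (permute_list p us) = 0"
proof -
  have "\<forall>us. length us = k \<longrightarrow> set us \<subseteq> carrier_vec n \<longrightarrow> F us = 0 \<longrightarrow> F (permute_list p us) = 0"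
    using p finite_lessThan
  proof (induction rule: permutes_induct)
    case id
    then show ?case by simp
  next
    case (swap a b q)
    show ?case
    proof (intro allI impI)
      fix us :: "complex vec list"
      assume us: "length us = k" "set us \<subseteq> carrier_vec n" and z: "F us = 0"
      let ?vs = "us[a := us ! b, b := us ! a]"
      have ab: "us ! a \<in> carrier_vec n" "us ! b \<in> carrier_vec n" using us swap by auto
      have "F ?vs = 0"
      proof (cases "a = b")
        case False
        then show ?thesis
          using alt_form_swap[OF F us, of a b "us ! b" "us ! a"] swap ab z by simp
      qed (use z in simp)
      moreover have "set ?vs \<subseteq> carrier_vec n" using us ab by (intro set_update)
      ultimately have "F (permute_list q ?vs) = 0" using swap us by simp
      then show "F (permute_list (Transposition.transpose a b \<circ> q) us) = 0"
        using swap us by (simp add: permute_list_compose permute_list_transpose)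
    qed
  qed
  then show ?thesis using us z by blast
qed

lemma alt_form_zero:
  assumes F: "alt_form n k F"
    and z: "\<And>I. I \<in> set (index_lists k n) \<Longrightarrow> F (map (unit_vec n) I) = 0"
    and us: "length us = k" "set us \<subseteq> carrier_vec n"
  shows "F us = 0"
proof -
  have base: "F (map (unit_vec n) gs) = 0" if gs: "length gs = k" "set gs \<subseteq> {..<n}" for gs
  proof (cases "distinct gs")
    case True
    have I: "sort gs \<in> set (index_lists k n)"
      using gs True by (auto simp: set_index_lists strict_sorted_iff)
    obtain p where p: "p permutes {..<length (sort gs)}" "permute_list p (sort gs) = gs"
      using mset_eq_permutation[of gs "sort gs"] by auto
    have "F (permute_list p (map (unit_vec n) (sort gs))) = 0"
      using p(1) gs z[OF I] by (intro alt_form_permute[OF F]) auto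
    then show ?thesis using p by (simp add: permute_list_map)
  next
    case False
    then obtain i j where "i < k" "j < k" "i \<noteq> j" "gs ! i = gs ! j"
      using gs by (auto simp: distinct_conv_nth)
    then show ?thesis using gs by (intro alt_formD(2)[OF F, of _ i j]) auto
  qed
  have "F us = 0"
    if "m \<le> k" "length us = k" "set us \<subseteq> carrier_vec n"
      "\<forall>j<k. m \<le> j \<longrightarrow> us ! j \<in> unit_vec n ` {..<n}" for m us
    using that
  proof (induction m arbitrary: us)
    case 0
    then have "\<forall>j<k. \<exists>g<n. us ! j = unit_vec n g" by auto
    then obtain g where g: "\<And>j. j < k \<Longrightarrow> g j < n \<and> us ! j = unit_vec n (g j)" by metis
    have "us = map (unit_vec n) (map g [0..<k])"
      using 0 g by (intro nth_equalityI) auto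
    moreover have "set (map g [0..<k]) \<subseteq> {..<n}" using g by auto
    ultimately show ?case using base[of "map g [0..<k]"] by simp
  next
    case (Suc m)
    have "F (us[m := unit_vec n i]) = 0" if "i < n" for i
      using Suc.prems that
      by (intro Suc.IH set_update) (auto simp: nth_list_update)
    then show ?case using alt_formD(1)[OF F Suc.prems(2,3), of m] Suc.prems by simp
  qed
  from this[of k us] us show ?thesis by simp
qed

lemma alt_form_wedge:
  assumes a: "a < length (index_lists k n)"
  shows "alt_form n k (\<lambda>us. wedge n us $ a)"
proof -
  define I where "I = index_lists k n ! a"
  have "I \<in> set (index_lists k n)" using a by (simp add: I_def)
  then have "length I = k" "set I \<subseteq> {..<n}" by (auto simp: set_index_lists)
  then have I: "I ! j < n" if "j < k" for j
    using that nth_mem[of j I] by (metis lessThan_iff subsetD)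
  define M where "M us = mat k k (\<lambda>(i, j). (us ! i :: complex vec) $ (I ! j))" for us
  have w: "wedge n us $ a = det (M us)" if "length us = k" for us
    using that a by (simp add: wedge_index I_def M_def)
  have M: "M us \<in> carrier_mat k k" for us by (simp add: M_def)
  have ME: "M us $$ (i, p i) = us ! i $ (I ! p i)" if "p permutes {0..<k}" "i < k" for us p i
    using that permutes_in_image[OF that(1), of i] by (simp add: M_def)
  have "wedge n us $ a = (\<Sum>m<n. us ! j $ m * wedge n (us[j := unit_vec n m]) $ a)"
    if us: "length us = k" "set us \<subseteq> carrier_vec n" and j: "j < k" for us j
  proof -
    define R where "R p = (\<Prod>i\<in>{0..<k} - {j}. us ! i $ (I ! p i))" for p
    have P: "(\<Prod>i = 0..<k. M (us[j := x]) $$ (i, p i)) = x $ (I ! p j) * R p"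
      if p: "p permutes {0..<k}" for x p
      using j us ME[OF p, of _ "us[j := x]"]
      by (subst prod.remove[of _ j]) (auto simp: R_def intro!: prod.cong)
    have D: "det (M (us[j := x])) =
        (\<Sum>p | p permutes {0..<k}. signof p * (x $ (I ! p j) * R p))" for x
      unfolding det_def'[OF M] using P by (intro sum.cong) auto
    have "det (M us) = (\<Sum>p | p permutes {0..<k}. signof p * (us ! j $ (I ! p j) * R p))"
      using D[of "us ! j"] by simp
    also have "\<dots> = (\<Sum>p | p permutes {0..<k}. signof p *
        ((\<Sum>m<n. us ! j $ m * unit_vec n m $ (I ! p j)) * R p))"
    proof (intro sum.cong refl)
      fix p assume "p \<in> {p. p permutes {0..<k}}"
      then have "p j < k" using j permutes_in_image[of p "{0..<k}" j] by auto
      then have "I ! p j < n" by (rule I)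
      then have "(\<Sum>m<n. us ! j $ m * unit_vec n m $ (I ! p j)) =
          (\<Sum>m<n. if m = I ! p j then us ! j $ m else 0)"
        by (intro sum.cong) auto
      then show "signof p * (us ! j $ (I ! p j) * R p) =
          signof p * ((\<Sum>m<n. us ! j $ m * unit_vec n m $ (I ! p j)) * R p)"
        using \<open>I ! p j < n\<close> by simp
    qed
    also have "\<dots> = (\<Sum>m<n. us ! j $ m * det (M (us[j := unit_vec n m])))"
      unfolding D sum_distrib_left sum_distrib_right
      by (subst sum.swap) (simp add: mult_ac)
    finally show ?thesis using us by (simp add: w)
  qed
  moreover have "wedge n us $ a = 0"
    if us: "length us = k" and ij: "i < k" "j < k" "i \<noteq> j" "us ! i = us ! j" for us i j
  proof -
    have "row (M us) i = row (M us) j" using ij by (intro eq_vecI) (auto simp: M_def)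
    then show ?thesis using det_identical_rows[OF M ij(3,1,2)] us by (simp add: w)
  qed
  ultimately show ?thesis unfolding alt_form_def by blast
qed

lemma wedge_basis:
  assumes a: "a < length (index_lists k n)" and b: "b < length (index_lists k n)"
  shows "wedge n (map (unit_vec n) (index_lists k n ! b)) $ a = (if a = b then 1 else 0)"
proof -
  define I J where "I = index_lists k n ! a" and "J = index_lists k n ! b"
  have "I \<in> set (index_lists k n)" "J \<in> set (index_lists k n)"
    using a b by (simp_all add: I_def J_def)
  then have I: "length I = k" "sorted_wrt (<) I" "set I \<subseteq> {..<n}"
    and J: "length J = k" "sorted_wrt (<) J" "set J \<subseteq> {..<n}" by (auto simp: set_index_lists)
  have In: "I ! i < n" if "i < k" for i using that I(1,3) nth_mem[of i I] by (metis lessThan_iff subsetD)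
  have Jn: "J ! i < n" if "i < k" for i using that J(1,3) nth_mem[of i J] by (metis lessThan_iff subsetD)
  define M where "M = mat k k (\<lambda>(i, j). (unit_vec n (J ! i) :: complex vec) $ (I ! j))"
  have "wedge n (map (unit_vec n) J) $ a = det (mat k k (\<lambda>(i, j). map (unit_vec n) J ! i $ (I ! j)))"
    using wedge_index[of "map (unit_vec n) J" k a n] J a by (simp add: I_def)
  also have "mat k k (\<lambda>(i, j). map (unit_vec n) J ! i $ (I ! j)) = M"
    using J by (auto simp: M_def)
  finally have w: "wedge n (map (unit_vec n) J) $ a = det M" .
  have MC: "M \<in> carrier_mat k k" by (simp add: M_def)
  show ?thesis
  proof (cases "a = b")
    case True
    then have "I = J" by (simp add: I_def J_def)
    moreover have "distinct J" using J by (simp add: strict_sorted_iff)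
    ultimately have "M = 1\<^sub>m k"
      using In J by (intro eq_matI) (auto simp: M_def nth_eq_iff_index_eq)
    then show ?thesis using w True by (simp add: J_def)
  next
    case False
    then have "I \<noteq> J" using distinct_index_lists a b by (simp add: I_def J_def nth_eq_iff_index_eq)
    then have "set I \<noteq> set J" using strict_sorted_equal I J by blast
    moreover have "card (set I) = card (set J)"
      using I J by (simp add: strict_sorted_iff distinct_card)
    ultimately have "\<not> set J \<subseteq> set I" using card_subset_eq[of "set I" "set J"] by auto
    then obtain x where "x \<in> set J" "x \<notin> set I" by blast
    then obtain i where i: "i < k" "J ! i \<notin> set I" using J(1) by (metis in_set_conv_nth)
    have "(\<Prod>i = 0..<k. M $$ (i, p i)) = 0" if "p permutes {0..<k}" for p
    proof (rule prod_zero)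
      have "p i < k" using permutes_in_image[OF that, of i] i by simp
      moreover from this have "I ! p i \<noteq> J ! i" using i(2) I(1) nth_mem[of "p i" I] by metis
      ultimately have "M $$ (i, p i) = 0" using i(1) In[of "p i"] Jn[of i] by (simp add: M_def)
      then show "\<exists>i\<in>{0..<k}. M $$ (i, p i) = 0" using i by auto
    qed simp
    then have "det M = 0" unfolding det_def'[OF MC] by (intro sum.neutral) auto
    then show ?thesis using w False by (simp add: J_def)
  qed
qed

lemma alt_form_expand:
  assumes F: "alt_form n k F" and us: "length us = k" "set us \<subseteq> carrier_vec n"
  shows "F us = (\<Sum>b<length (index_lists k n).
    wedge n us $ b * F (map (unit_vec n) (index_lists k n ! b)))"
proof -
  define N where "N = length (index_lists k n)"
  define c where "c b = F (map (unit_vec n) (index_lists k n ! b))" for b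
  define G where "G us = F us - (\<Sum>b<N. wedge n us $ b * c b)" for us
  have W: "alt_form n k (\<lambda>us. wedge n us $ b)" if "b < N" for b
    using that alt_form_wedge by (simp add: N_def)
  have "G us = (\<Sum>m<n. us ! j $ m * G (us[j := unit_vec n m]))"
    if us: "length us = k" "set us \<subseteq> carrier_vec n" "j < k" for us j
  proof -
    have "(\<Sum>b<N. wedge n us $ b * c b) =
        (\<Sum>b<N. (\<Sum>m<n. us ! j $ m * wedge n (us[j := unit_vec n m]) $ b) * c b)"
      using alt_formD(1)[OF W us] by (intro sum.cong) auto
    also have "\<dots> = (\<Sum>m<n. us ! j $ m * (\<Sum>b<N. wedge n (us[j := unit_vec n m]) $ b * c b))"
      unfolding sum_distrib_left sum_distrib_right by (subst sum.swap) (simp add: mult_ac)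
    finally show ?thesis
      using alt_formD(1)[OF F us] by (simp add: G_def right_diff_distrib sum_subtractf)
  qed
  moreover have "G us = 0"
    if "length us = k" "set us \<subseteq> carrier_vec n" "i < k" "j < k" "i \<noteq> j" "us ! i = us ! j" for us i j
    using alt_formD(2)[OF F that] alt_formD(2)[OF W that] by (simp add: G_def)
  ultimately have G: "alt_form n k G" unfolding alt_form_def by blast
  have "G us = 0"
  proof (rule alt_form_zero[OF G _ us])
    fix I assume "I \<in> set (index_lists k n)"
    then obtain a where a: "a < N" "I = index_lists k n ! a"
      by (auto simp: N_def in_set_conv_nth)
    have "(\<Sum>b<N. wedge n (map (unit_vec n) I) $ b * c b) = (\<Sum>b<N. if b = a then c b else 0)"
      using a wedge_basis[of _ k n a] by (intro sum.cong) (auto simp: N_def)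
    then show "G (map (unit_vec n) I) = 0" using a by (simp add: G_def c_def)
  qed
  then show ?thesis by (simp add: G_def N_def c_def)
qed

lemma alt_form_wedge_action:
  assumes a: "a < length (index_lists k n)" and B: "B \<in> carrier_mat n n"
  shows "alt_form n k (\<lambda>us. wedge_action n B us $ a)"
proof -
  define w where "w us = wedge n us $ a" for us
  have w: "alt_form n k w" using alt_form_wedge[OF a] unfolding w_def .
  have act: "wedge_action n B us $ a = w us + (\<Sum>l<k. w (us[l := B *\<^sub>v us ! l]))"
    if "length us = k" for us
    using wedge_action_index[OF that a] by (simp add: w_def)
  have BC: "B *\<^sub>v u \<in> carrier_vec n" for u using B by (intro carrier_vecI) simp
  have slot: "w (us[l := B *\<^sub>v us ! l]) =
      (\<Sum>m<n. us ! j $ m * w (us[j := unit_vec n m, l := B *\<^sub>v us[j := unit_vec n m] ! l]))"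
    if us: "length us = k" "set us \<subseteq> carrier_vec n" and j: "j < k" and l: "l < k" for us j l
  proof (cases "l = j")
    case False
    then show ?thesis
      using alt_formD(1)[OF w _ set_update[OF us(2) BC], where j = j] us j
      by (simp add: list_update_swap)
  next
    case True
    have uj: "us ! j \<in> carrier_vec n" using us j by auto
    have e: "w (us[j := B *\<^sub>v x]) = (\<Sum>i<n. (B *\<^sub>v x) $ i * w (us[j := unit_vec n i]))" for x
      by (rule alt_form_slot[OF w us j BC])
    have "(B *\<^sub>v (us ! j)) $ i = (\<Sum>m<n. us ! j $ m * (B *\<^sub>v unit_vec n m) $ i)" if "i < n" for i
      using that B uj
      by (auto simp: scalar_prod_def atLeast0LessThan mult.commute if_distrib cong: if_cong
          intro!: sum.cong)
    then have "w (us[j := B *\<^sub>v us ! j]) =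
        (\<Sum>i<n. (\<Sum>m<n. us ! j $ m * (B *\<^sub>v unit_vec n m) $ i) * w (us[j := unit_vec n i]))"
      unfolding e by (intro sum.cong) auto
    also have "\<dots> = (\<Sum>m<n. us ! j $ m * w (us[j := B *\<^sub>v unit_vec n m]))"
      unfolding e sum_distrib_left sum_distrib_right
      by (subst sum.swap) (simp add: mult_ac del: index_mult_mat_vec)
    finally show ?thesis using True us j by simp
  qed
  have "wedge_action n B us $ a =
      (\<Sum>m<n. us ! j $ m * wedge_action n B (us[j := unit_vec n m]) $ a)"
    if us: "length us = k" "set us \<subseteq> carrier_vec n" and j: "j < k" for us j
  proof -
    have "(\<Sum>l<k. w (us[l := B *\<^sub>v us ! l])) = (\<Sum>m<n. us ! j $ m *
        (\<Sum>l<k. w (us[j := unit_vec n m, l := B *\<^sub>v us[j := unit_vec n m] ! l])))"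
      unfolding sum_distrib_left using slot[OF us j] by (subst sum.swap) (auto intro: sum.cong)
    then show ?thesis
      using alt_formD(1)[OF w us j] us by (simp add: act sum.distrib distrib_left)
  qed
  moreover have "wedge_action n B us $ a = 0"
    if us: "length us = k" "set us \<subseteq> carrier_vec n"
      and ij: "i < k" "j < k" "i \<noteq> j" "us ! i = us ! j" for us i j
  proof -
    have z: "w (us[l := B *\<^sub>v us ! l]) = 0" if "l \<noteq> i" "l \<noteq> j" for l
      using alt_formD(2)[OF w _ set_update[OF us(2) BC] ij(1,2,3)] us ij that by simp
    have "(\<Sum>l<k. w (us[l := B *\<^sub>v us ! l])) = (\<Sum>l\<in>{i, j}. w (us[l := B *\<^sub>v us ! l]))"
      using z ij by (intro sum.mono_neutral_right) auto
    also have "\<dots> = w (us[i := B *\<^sub>v us ! i, j := us ! j]) + w (us[i := us ! i, j := B *\<^sub>v us ! j])"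
    proof -
      have "us[i := x, j := us ! j] = us[i := x]" for x
        using ij(3) by (metis list_update_id list_update_swap)
      moreover have "us[i := us ! i, j := x] = us[j := x]" for x by (simp only: list_update_id)
      ultimately show ?thesis using ij(3) by (simp only: sum.insert sum.empty finite.intros) simp
    qed
    also have "\<dots> = 0"
    proof -
      have "us ! j \<in> carrier_vec n" using us ij(2) nth_mem[of j us] by auto
      then show ?thesis using alt_form_swap[OF w us ij(1,2,3) BC] ij(4) by simp
    qed
    finally show ?thesis using alt_formD(2)[OF w us ij] us by (simp add: act)
  qed
  ultimately show ?thesis unfolding alt_form_def by blast
qed

theorem wedge_op_wedge:
  assumes B: "B \<in> carrier_mat n n" and us: "length us = k" "set us \<subseteq> carrier_vec n"
  shows "wedge_op k n B *\<^sub>v wedge n us = wedge_action n B us"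
proof (rule eq_vecI)
  fix a assume "a < dim_vec (wedge_action n B us)"
  then have a: "a < length (index_lists k n)" using wedge_action_carrier[OF us(1), of n B] by auto
  show "(wedge_op k n B *\<^sub>v wedge n us) $ a = wedge_action n B us $ a"
    using a wedge_carrier[OF us(1), of n] alt_form_expand[OF alt_form_wedge_action[OF a B] us]
    by (auto simp: wedge_op_def scalar_prod_def mat_of_cols_index atLeast0LessThan mult.commute
        intro!: sum.cong)
qed (use wedge_action_carrier[OF us(1), of n B] in \<open>auto simp: wedge_op_def\<close>)

end

theory Submission
  imports Defs "Jordan_Normal_Form.Schur_Decomposition" "Jordan_Normal_Form.DL_Rank"
begin

text \<open>
  Write a point \<open>W\<close> of the Grassmannian as the range of an \<open>n \<times> k\<close> matrix \<open>A\<close> with left inverse \<open>L\<close>,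
  so that \<open>A L\<close> is a projection onto \<open>W\<close>. The bundle map sends \<open>T : V \<rightarrow> W\<close> to \<open>T|\<^sub>W + tr(B T) id\<^sub>W\<close>.
  If \<open>B W\<close> is not contained in \<open>W\<close>, then \<open>tr(B T)\<close> can be adjusted without changing \<open>T|\<^sub>W\<close>; if
  \<open>tr(B A L) \<noteq> -1\<close>, then it can be corrected by a multiple of \<open>A L\<close>. In both cases the map is
  surjective. Otherwise \<open>id\<^sub>W\<close> is not in its image. So \<open>B\<close> lies in the degenerate locus iff it has
  a \<open>k\<close>-dimensional invariant subspace on which its trace is \<open>-1\<close>.

  The wedge of a basis of such a subspace is in the kernel of the operator on \<open>\<Lambda>\<^sup>k V\<close>.
  Conversely, a left kernel vector of that operator is an alternating form \<open>F\<close> with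
  \<open>F u + (\<Sum>j. F (u with B u\<^sub>j in slot j)) = 0\<close>. Evaluating it on vectors of a basis in which
  \<open>B\<close> is triangular, at the smallest index list where it does not vanish, gives \<open>k\<close> eigenvalues with
  sum \<open>-1\<close>. A triangular form of \<open>B\<close> that lists these eigenvalues first provides the subspace.
\<close>

section \<open>Surjectivity of the bundle map\<close>

definition mat_trace :: "'a :: comm_ring_1 mat \<Rightarrow> 'a" where
  "mat_trace M = (\<Sum>i<dim_row M. M $$ (i, i))"

text \<open>The two products expand to the same double sum. The factors may be rectangular, which is
  what moves a trace from \<open>n\<close> by \<open>n\<close> matrices on V to \<open>k\<close> by
  \<open>k\<close> matrices on W.\<close>

lemma mat_trace_comm:
  assumes "X \<in> carrier_mat n m" "Y \<in> carrier_mat m n"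
  shows "mat_trace (X * Y) = mat_trace (Y * X)"
proof -
  have "mat_trace (X * Y) = (\<Sum>i<n. \<Sum>j<m. X $$ (i, j) * Y $$ (j, i))"
    using assms by (simp add: mat_trace_def scalar_prod_def atLeast0LessThan)
  also have "\<dots> = (\<Sum>j<m. \<Sum>i<n. Y $$ (j, i) * X $$ (i, j))"
    by (subst sum.swap) (simp add: mult.commute)
  finally show ?thesis
    using assms by (simp add: mat_trace_def scalar_prod_def atLeast0LessThan)
qed

lemma mat_trace_add:
  assumes "X \<in> carrier_mat n n" "Y \<in> carrier_mat n n"
  shows "mat_trace (X + Y) = mat_trace X + mat_trace Y"
  using assms by (simp add: mat_trace_def sum.distrib)

lemma mat_trace_smult: "X \<in> carrier_mat n n \<Longrightarrow> mat_trace (c \<cdot>\<^sub>m X) = c * mat_trace X"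
  by (simp add: mat_trace_def sum_distrib_left)

section \<open>The bundle map in matrix form\<close>

lemma hom_space_mat:
  assumes M: "M \<in> carrier_mat n n" and R: "\<And>v. v \<in> carrier_vec n \<Longrightarrow> M *\<^sub>v v \<in> W"
  shows "(\<lambda>v\<in>carrier_vec n. M *\<^sub>v v) \<in> hom_space n (carrier_vec n) W"
  using M R
  by (auto simp: hom_space_def LinearCombinations.module_hom_def module_vec_simps
      mult_add_distrib_mat_vec mult_mat_vec)

text \<open>The columns of \<open>M\<close> are the values of \<open>T\<close> on the unit vectors.
  Extensionality of \<open>T\<close> is what upgrades agreement on \<open>carrier_vec n\<close> to
  equality of functions.\<close>

lemma hom_space_mat_ex:
  assumes T: "T \<in> hom_space n (carrier_vec n) W" and W: "W \<subseteq> carrier_vec n"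
  obtains M where "M \<in> carrier_mat n n" "\<And>v. v \<in> carrier_vec n \<Longrightarrow> M *\<^sub>v v \<in> W"
    "T = (\<lambda>v\<in>carrier_vec n. M *\<^sub>v v)"
proof -
  define M where "M = mat n n (\<lambda>(i, j). T (unit_vec n j) $ i)"
  have M: "M \<in> carrier_mat n n" by (simp add: M_def)
  have eq: "T v = M *\<^sub>v v" if v: "v \<in> carrier_vec n" for v
  proof (rule eq_vecI)
    show "dim_vec (T v) = dim_vec (M *\<^sub>v v)"
      using hom_spaceD(1)[OF T v] W M by auto
    fix i assume "i < dim_vec (M *\<^sub>v v)"
    then have i: "i < n" using M by simp
    show "T v $ i = (M *\<^sub>v v) $ i"
      using hom_space_index[OF T W v i] i v M
      by (simp add: M_def scalar_prod_def atLeast0LessThan mult.commute)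
  qed
  have "T = (\<lambda>v\<in>carrier_vec n. M *\<^sub>v v)"
  proof (rule extensionalityI[where A = "carrier_vec n"])
    show "T \<in> extensional (carrier_vec n)" using T by (simp add: hom_space_def)
  qed (simp_all add: eq)
  then show thesis using that[OF M] hom_spaceD(1)[OF T] eq by metis
qed

text \<open>The scalar in \<open>f_map_eq\<close> sums the diagonal entries of \<open>B * M\<close>,
  so the fibre map takes the coordinate-free form of restriction to W plus a trace multiple of the
  identity.\<close>

lemma f_map_mat:
  assumes W: "W \<subseteq> carrier_vec n" and B: "B \<in> carrier_mat n n"
    and M: "M \<in> carrier_mat n n" and R: "\<And>v. v \<in> carrier_vec n \<Longrightarrow> M *\<^sub>v v \<in> W"
  shows "f_map n B W (\<lambda>v\<in>carrier_vec n. M *\<^sub>v v) =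
    (\<lambda>w\<in>W. M *\<^sub>v w + mat_trace (B * M) \<cdot>\<^sub>v w)"
proof (rule extensionalityI[where A = W])
  fix w assume w: "w \<in> W"
  have "(B *\<^sub>v (M *\<^sub>v unit_vec n j)) $ j = (B * M) $$ (j, j)" if "j < n" for j
  proof -
    have "M *\<^sub>v unit_vec n j = col M j" using M that by (intro eq_vecI) auto
    then show ?thesis using that B M by simp
  qed
  then have "(\<Sum>j<n. (B *\<^sub>v (\<lambda>v\<in>carrier_vec n. M *\<^sub>v v) (unit_vec n j)) $ j) = mat_trace (B * M)"
    using B by (simp add: mat_trace_def del: index_mult_mat_vec index_mult_mat(1))
  then show "f_map n B W (\<lambda>v\<in>carrier_vec n. M *\<^sub>v v) w =
      (\<lambda>w\<in>W. M *\<^sub>v w + mat_trace (B * M) \<cdot>\<^sub>v w) w"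
    using f_map_eq[OF hom_space_mat[OF M R] W B w] w W by auto
qed (auto simp: f_map_def)

lemma f_map_image:
  assumes W: "W \<subseteq> carrier_vec n" and B: "B \<in> carrier_mat n n"
  shows "f_map n B W ` hom_space n (carrier_vec n) W =
    {\<lambda>w\<in>W. M *\<^sub>v w + mat_trace (B * M) \<cdot>\<^sub>v w | M.
      M \<in> carrier_mat n n \<and> (\<forall>v\<in>carrier_vec n. M *\<^sub>v v \<in> W)}"
proof (intro equalityI subsetI)
  fix g assume "g \<in> f_map n B W ` hom_space n (carrier_vec n) W"
  then obtain T where T: "T \<in> hom_space n (carrier_vec n) W" "g = f_map n B W T" by blast
  obtain M where M: "M \<in> carrier_mat n n" "\<And>v. v \<in> carrier_vec n \<Longrightarrow> M *\<^sub>v v \<in> W"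
    and TM: "T = (\<lambda>v\<in>carrier_vec n. M *\<^sub>v v)"
    using hom_space_mat_ex[OF T(1) W] by metis
  show "g \<in> {\<lambda>w\<in>W. M *\<^sub>v w + mat_trace (B * M) \<cdot>\<^sub>v w | M.
      M \<in> carrier_mat n n \<and> (\<forall>v\<in>carrier_vec n. M *\<^sub>v v \<in> W)}"
    using f_map_mat[OF W B M] M T(2) TM by blast
next
  fix g assume "g \<in> {\<lambda>w\<in>W. M *\<^sub>v w + mat_trace (B * M) \<cdot>\<^sub>v w | M.
      M \<in> carrier_mat n n \<and> (\<forall>v\<in>carrier_vec n. M *\<^sub>v v \<in> W)}"
  then obtain M where M: "M \<in> carrier_mat n n" "\<And>v. v \<in> carrier_vec n \<Longrightarrow> M *\<^sub>v v \<in> W"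
    and g: "g = (\<lambda>w\<in>W. M *\<^sub>v w + mat_trace (B * M) \<cdot>\<^sub>v w)" by blast
  show "g \<in> f_map n B W ` hom_space n (carrier_vec n) W"
    using f_map_mat[OF W B M] hom_space_mat[OF M] g by (metis imageI)
qed

section \<open>Column ranges of left-invertible matrices and the projection onto them\<close>

definition col_range :: "'a :: comm_ring_1 mat \<Rightarrow> 'a vec set" where
  "col_range A = (\<lambda>x. A *\<^sub>v x) ` carrier_vec (dim_col A)"

text \<open>Precomposing \<open>g\<close> with the projection \<open>A * L\<close> extends it to all
  of V, since that projection fixes every vector of \<open>col_range A\<close>.\<close>

lemma hom_space_extend:
  assumes A: "A \<in> carrier_mat n k" and L: "L \<in> carrier_mat k n" and LA: "L * A = 1\<^sub>m k"
    and g: "g \<in> hom_space n (col_range A) (col_range A)"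
  obtains G where "G \<in> carrier_mat n n" "\<And>v. v \<in> carrier_vec n \<Longrightarrow> G *\<^sub>v v \<in> col_range A"
    "\<And>w. w \<in> col_range A \<Longrightarrow> g w = G *\<^sub>v w"
proof -
  define T where "T = (\<lambda>v\<in>carrier_vec n. g (A *\<^sub>v (L *\<^sub>v v)))"
  have R: "A *\<^sub>v (L *\<^sub>v v) \<in> col_range A" for v
  proof -
    have "L *\<^sub>v v \<in> carrier_vec (dim_col A)" using A L by (intro carrier_vecI) simp
    then show ?thesis unfolding col_range_def by (rule imageI)
  qed
  have T: "T \<in> hom_space n (carrier_vec n) (col_range A)"
  proof -
    have add: "A *\<^sub>v (L *\<^sub>v (u + v)) = A *\<^sub>v (L *\<^sub>v u) + A *\<^sub>v (L *\<^sub>v v)"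
      if "u \<in> carrier_vec n" "v \<in> carrier_vec n" for u v
      using that A L by (simp add: mult_add_distrib_mat_vec[of _ k n] mult_add_distrib_mat_vec[of _ n k])
    have smult: "A *\<^sub>v (L *\<^sub>v (c \<cdot>\<^sub>v v)) = c \<cdot>\<^sub>v (A *\<^sub>v (L *\<^sub>v v))" if "v \<in> carrier_vec n" for c v
      using that A L by (simp add: mult_mat_vec[of _ k n] mult_mat_vec[of _ n k])
    show ?thesis
      using hom_spaceD(1)[OF g R] hom_spaceD(2)[OF g R R] hom_spaceD(3)[OF g R]
      by (simp add: T_def hom_space_def LinearCombinations.module_hom_def module_vec_simps
          add smult)
  qed
  have W: "col_range A \<subseteq> carrier_vec n" using A by (auto simp: col_range_def)
  obtain G where G: "G \<in> carrier_mat n n" "\<And>v. v \<in> carrier_vec n \<Longrightarrow> G *\<^sub>v v \<in> col_range A"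
    "T = (\<lambda>v\<in>carrier_vec n. G *\<^sub>v v)"
    using hom_space_mat_ex[OF T W] by metis
  have "g w = G *\<^sub>v w" if w: "w \<in> col_range A" for w
  proof -
    obtain x where x: "x \<in> carrier_vec k" "w = A *\<^sub>v x" using w A by (auto simp: col_range_def)
    have "L *\<^sub>v w = x" using x assoc_mult_mat_vec[OF L A, of x] by (simp add: LA)
    then have "T w = g w" using W w x(2) by (auto simp: T_def)
    then show ?thesis using G(3) W w by auto
  qed
  then show thesis using that G by blast
qed


text \<open>Every column of \<open>M\<close> lies in \<open>col_range A\<close>, where
  \<open>A * L\<close> acts as the identity.\<close>

lemma col_range_left_inverse:
  assumes A: "A \<in> carrier_mat n k" and L: "L \<in> carrier_mat k n" and LA: "L * A = 1\<^sub>m k"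
    and M: "M \<in> carrier_mat n m" "\<And>v. v \<in> carrier_vec m \<Longrightarrow> M *\<^sub>v v \<in> col_range A"
  shows "A * L * M = M"
proof (rule mat_col_eqI)
  fix j assume "j < dim_col M"
  then have j: "j < m" using M by simp
  have "col M j = M *\<^sub>v unit_vec m j" using M(1) j by (intro eq_vecI) auto
  then have "col M j \<in> col_range A" using M(2)[of "unit_vec m j"] by simp
  then obtain x where x: "x \<in> carrier_vec k" "col M j = A *\<^sub>v x"
    using A by (auto simp: col_range_def)
  have "col (A * L * M) j = (A * L) *\<^sub>v col M j"
    using A L M(1) j by (intro col_mult2[of _ n n]) auto
  also have "\<dots> = A *\<^sub>v (L *\<^sub>v col M j)"
    using A L M(1) j by (intro assoc_mult_mat_vec[of _ n k _ n]) auto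
  also have "L *\<^sub>v col M j = x" using x assoc_mult_mat_vec[OF L A, of x] by (simp add: LA)
  finally show "col (A * L * M) j = col M j" using x by simp
qed (use A M in auto)

text \<open>The identity of W has no preimage. A preimage \<open>M\<close> would act on W as the
  scalar \<open>1 - c\<close>, where \<open>c\<close> is the trace of \<open>B * M\<close>.
  Invariance lets this trace be computed on W, giving
  \<open>c = (1 - c) * mat_trace (L * B * A) = c - 1\<close>.\<close>

lemma f_map_not_surj:
  assumes A: "A \<in> carrier_mat n k" and L: "L \<in> carrier_mat k n" and LA: "L * A = 1\<^sub>m k"
    and B: "B \<in> carrier_mat n n"
    and inv: "B * A = A * (L * B * A)" and tr: "mat_trace (L * B * A) = - 1"
  shows "\<not> hom_space n (col_range A) (col_range A)
    \<subseteq> f_map n B (col_range A) ` hom_space n (carrier_vec n) (col_range A)"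
proof
  let ?W = "col_range A"
  assume sub: "hom_space n ?W ?W \<subseteq> f_map n B ?W ` hom_space n (carrier_vec n) ?W"
  have W: "?W \<subseteq> carrier_vec n" using A by (auto simp: col_range_def)
  have "(\<lambda>w\<in>?W. w) \<in> hom_space n ?W ?W"
  proof -
    have "u + v \<in> ?W" if "u \<in> ?W" "v \<in> ?W" for u v
      using that A by (auto simp: col_range_def mult_add_distrib_mat_vec[OF A, symmetric])
    moreover have "c \<cdot>\<^sub>v v \<in> ?W" if "v \<in> ?W" for c v
      using that A by (auto simp: col_range_def mult_mat_vec[OF A, symmetric])
    ultimately show ?thesis
      by (auto simp: hom_space_def LinearCombinations.module_hom_def module_vec_simps)
  qed
  then obtain M where M: "M \<in> carrier_mat n n" "\<And>v. v \<in> carrier_vec n \<Longrightarrow> M *\<^sub>v v \<in> ?W"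
    and id: "(\<lambda>w\<in>?W. w) = (\<lambda>w\<in>?W. M *\<^sub>v w + mat_trace (B * M) \<cdot>\<^sub>v w)"
    using sub unfolding f_map_image[OF W B] by blast
  define c where "c = mat_trace (B * M)"
  have MA: "M * A = (1 - c) \<cdot>\<^sub>m A"
  proof (rule mat_col_eqI)
    fix j assume "j < dim_col ((1 - c) \<cdot>\<^sub>m A)"
    then have j: "j < k" using A by simp
    have "A *\<^sub>v unit_vec k j \<in> ?W" using A by (auto simp: col_range_def)
    moreover have "A *\<^sub>v unit_vec k j = col A j" using A j by (intro eq_vecI) auto
    ultimately have w: "col A j \<in> ?W" by simp
    have "col A j = M *\<^sub>v col A j + c \<cdot>\<^sub>v col A j"
      using fun_cong[OF id, of "col A j"] w by (simp add: c_def)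
    then have "col A j $ i = (M *\<^sub>v col A j) $ i + c * col A j $ i" if "i < n" for i
    proof -
      have "col A j $ i = (M *\<^sub>v col A j + c \<cdot>\<^sub>v col A j) $ i"
        using \<open>col A j = M *\<^sub>v col A j + c \<cdot>\<^sub>v col A j\<close> by simp
      then show ?thesis using that A M(1) by (simp del: index_mult_mat_vec)
    qed
    then have "(M *\<^sub>v col A j) $ i = (1 - c) * col A j $ i" if "i < n" for i
      using that by (simp add: algebra_simps del: index_mult_mat_vec)
    then show "col (M * A) j = col ((1 - c) \<cdot>\<^sub>m A) j"
      using A M(1) j by (intro eq_vecI) auto
  qed (use A M in auto)
  let ?C = "L * B * A"
  have C: "?C \<in> carrier_mat k k" using A L B by simp
  \<comment> \<open>Inserting the projection puts \<open>A\<close> next to \<open>B\<close>, where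
    invariance applies. Cyclicity then carries \<open>A\<close> to the right end, so that
    \<open>M\<close> enters only through \<open>M * A\<close>.\<close>
  have "B * M = B * (A * L * M)" using col_range_left_inverse[OF A L LA M] by simp
  also have "\<dots> = (B * A) * (L * M)"
    using A L B M(1) by (simp add: assoc_mult_mat[of _ n k _ n _ n] assoc_mult_mat[of _ n n _ k _ n])
  also have "\<dots> = A * (?C * (L * M))"
    unfolding inv using A L C M(1) by (simp add: assoc_mult_mat[of _ n k _ k _ n])
  finally have "c = mat_trace (A * (?C * (L * M)))" by (simp add: c_def)
  also have "\<dots> = mat_trace (?C * (L * M) * A)"
    using A L C M(1) by (intro mat_trace_comm[of _ n k]) auto
  also have "?C * (L * M) * A = ?C * (L * (M * A))"
    using A L C M(1) by (simp add: assoc_mult_mat[of _ k k _ n _ k] assoc_mult_mat[of _ k n _ n _ k])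
  also have "\<dots> = (1 - c) \<cdot>\<^sub>m ?C"
    unfolding MA mult_smult_distrib[OF L A] LA mult_smult_distrib[OF C one_carrier_mat]
      right_mult_one_mat[OF C] ..
  also have "mat_trace \<dots> = - (1 - c)" using mat_trace_smult[OF C] tr by simp
  finally show False by simp
qed

text \<open>An extension \<open>G\<close> of \<open>g\<close> restricts to \<open>g\<close> on W,
  but the trace term spoils it. Adding a map \<open>A * Y\<close> with values in W that is a scalar
  on W leaves enough freedom to cancel that term.\<close>

lemma f_map_surj:
  assumes A: "A \<in> carrier_mat n k" and L: "L \<in> carrier_mat k n" and LA: "L * A = 1\<^sub>m k"
    and B: "B \<in> carrier_mat n n"
    and no: "\<not> (B * A = A * (L * B * A) \<and> mat_trace (L * B * A) = - 1)"
  shows "hom_space n (col_range A) (col_range A)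
    \<subseteq> f_map n B (col_range A) ` hom_space n (carrier_vec n) (col_range A)"
proof
  let ?W = "col_range A"
  have W: "?W \<subseteq> carrier_vec n" using A by (auto simp: col_range_def)
  have BA: "B * A \<in> carrier_mat n k" and AL: "A * L \<in> carrier_mat n n" using A B L by simp_all
  fix g assume g: "g \<in> hom_space n ?W ?W"
  obtain G where G: "G \<in> carrier_mat n n" "\<And>v. v \<in> carrier_vec n \<Longrightarrow> G *\<^sub>v v \<in> ?W"
    and gG: "\<And>w. w \<in> ?W \<Longrightarrow> g w = G *\<^sub>v w"
    using hom_space_extend[OF A L LA g] by metis
  \<comment> \<open>On W the map \<open>A * Y\<close> is multiplication by \<open>c\<close>. The
    trace equation says that \<open>B * (G + A * Y)\<close> has trace \<open>- c\<close>, so the two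
    multiples of the identity cancel.\<close>
  obtain Y c where Y: "Y \<in> carrier_mat k n" "Y * A = c \<cdot>\<^sub>m 1\<^sub>m k"
    and tr: "c + mat_trace (B * G) + mat_trace (B * (A * Y)) = 0"
  proof (cases "mat_trace (L * B * A) = - 1")
    case False
    define t where "t = mat_trace (L * B * A)"
    \<comment> \<open>With \<open>Y\<close> equal to \<open>d\<close> times \<open>L\<close>, the
      scalar is \<open>c = d\<close>, and the required equation becomes
      \<open>d * (1 + t) = - mat_trace (B * G)\<close>.\<close>
    define d where "d = - mat_trace (B * G) / (1 + t)"
    have t: "mat_trace (B * (A * L)) = t"
      using mat_trace_comm[OF BA L] A B L
      by (simp add: t_def assoc_mult_mat[of _ n n _ k _ n] assoc_mult_mat[of _ k n _ n _ k])
    have "1 + t \<noteq> 0" using False by (simp add: t_def add_eq_0_iff)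
    have "B * (A * (d \<cdot>\<^sub>m L)) = d \<cdot>\<^sub>m (B * (A * L))"
      by (simp only: mult_smult_distrib[OF A L] mult_smult_distrib[OF B AL])
    then have "mat_trace (B * (A * (d \<cdot>\<^sub>m L))) = d * t"
      using t mat_trace_smult[of "B * (A * L)" n d] B AL by simp
    moreover have "d + d * t = d * (1 + t)" by (simp add: algebra_simps)
    moreover have "\<dots> = - mat_trace (B * G)" using \<open>1 + t \<noteq> 0\<close> by (simp add: d_def)
    ultimately have "d + mat_trace (B * G) + mat_trace (B * (A * (d \<cdot>\<^sub>m L))) = 0"
      by (metis (no_types, lifting) add.assoc add.commute add.right_inverse)
    moreover have "(d \<cdot>\<^sub>m L) * A = d \<cdot>\<^sub>m 1\<^sub>m k" using A L LA by (simp add: mult_smult_assoc_mat)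
    ultimately show thesis using that[of "d \<cdot>\<^sub>m L" d] L by simp
  next
    case True
    \<comment> \<open>\<open>Q\<close> is the complementary projection. It annihilates W, so every
      \<open>Y = E * Q\<close> gives \<open>c = 0\<close>, and \<open>N\<close> below measures how
      far \<open>B\<close> moves W out of itself.\<close>
    define Q where "Q = 1\<^sub>m n - A * L"
    have Q: "Q \<in> carrier_mat n n" using AL by (simp add: Q_def minus_carrier_mat)
    have QA: "Q * A = 0\<^sub>m n k"
      using A unfolding Q_def minus_mult_distrib_mat[OF one_carrier_mat AL A]
        assoc_mult_mat[OF A L A] LA by simp
    define N where "N = Q * (B * A)"
    have N: "N \<in> carrier_mat n k" using Q BA by (simp add: N_def)
    have "N = B * A - A * (L * B * A)"
      unfolding N_def Q_def minus_mult_distrib_mat[OF one_carrier_mat AL BA]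
        assoc_mult_mat[OF A L BA] assoc_mult_mat[OF L B A] left_mult_one_mat[OF BA] ..
    moreover have "B * A \<noteq> A * (L * B * A)" using no True by simp
    moreover have "B * A = A * (L * B * A)" if "B * A - A * (L * B * A) = 0\<^sub>m n k"
    proof (rule eq_matI)
      fix i j assume "i < dim_row (A * (L * B * A))" "j < dim_col (A * (L * B * A))"
      then show "(B * A) $$ (i, j) = (A * (L * B * A)) $$ (i, j)"
        using A B arg_cong[OF that, of "\<lambda>X. X $$ (i, j)"] by (simp del: index_mult_mat(1))
    qed (use A B in auto)
    ultimately have "N \<noteq> 0\<^sub>m n k" by auto
    then obtain i j where ij: "i < n" "j < k" "N $$ (i, j) \<noteq> 0"
      using N eq_matI[of "0\<^sub>m n k" N] by force
    \<comment> \<open>The single possibly nonzero entry of \<open>E\<close> meets the nonzero entry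
      of \<open>N\<close> in the trace of \<open>E * N\<close> and is scaled to give exactly
      \<open>- mat_trace (B * G)\<close>.\<close>
    define E where "E = mat k n (\<lambda>(a, b). if a = j \<and> b = i then - mat_trace (B * G) / N $$ (i, j) else 0)"
    have E: "E \<in> carrier_mat k n" by (simp add: E_def)
    have "mat_trace (B * (A * (E * Q))) = mat_trace ((B * A) * (E * Q))"
      using A B E Q by (simp add: assoc_mult_mat[of _ n n _ k _ n])
    also have "\<dots> = mat_trace (E * N)"
      using E Q BA by (subst mat_trace_comm[OF BA]) (auto simp: N_def assoc_mult_mat[of _ k n _ n _ k])
    also have "\<dots> = (\<Sum>a<k. \<Sum>b<n. E $$ (a, b) * N $$ (b, a))"
      using E N by (simp add: mat_trace_def scalar_prod_def atLeast0LessThan)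
    also have "\<dots> = (\<Sum>a<k. \<Sum>b<n. if b = i then if a = j then - mat_trace (B * G) else 0 else 0)"
      using ij by (intro sum.cong) (auto simp: E_def)
    also have "\<dots> = - mat_trace (B * G)" using ij by simp
    finally have "0 + mat_trace (B * G) + mat_trace (B * (A * (E * Q))) = 0" by simp
    moreover have "(E * Q) * A = 0 \<cdot>\<^sub>m 1\<^sub>m k"
      using A E Q by (auto simp: assoc_mult_mat[of _ k n _ n _ k] QA)
    ultimately show thesis using that[of "E * Q" 0] E Q by simp
  qed
  define M where "M = G + A * Y"
  have AY: "A * Y \<in> carrier_mat n n" using A Y by simp
  have M: "M \<in> carrier_mat n n" using G A Y by (simp add: M_def)
  have R: "M *\<^sub>v v \<in> ?W" if v: "v \<in> carrier_vec n" for v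
  proof -
    obtain x where x: "x \<in> carrier_vec k" "G *\<^sub>v v = A *\<^sub>v x"
      using G(2)[OF v] A by (auto simp: col_range_def)
    have "Y *\<^sub>v v \<in> carrier_vec k" using Y v by simp
    then have "M *\<^sub>v v = A *\<^sub>v (x + Y *\<^sub>v v)"
      using x G(1) A Y(1) v AY
      by (simp add: M_def add_mult_distrib_mat_vec[of _ n n] mult_add_distrib_mat_vec[of _ n k])
    then show ?thesis using x \<open>Y *\<^sub>v v \<in> carrier_vec k\<close> A by (auto simp: col_range_def)
  qed
  have trM: "mat_trace (B * M) = - c"
    using tr B G(1) AY
    by (simp add: M_def mult_add_distrib_mat[of _ n n] mat_trace_add[of _ n] algebra_simps
        add_eq_0_iff)
  have "g = (\<lambda>w\<in>?W. M *\<^sub>v w + mat_trace (B * M) \<cdot>\<^sub>v w)"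
  proof (rule extensionalityI[where A = "?W"])
    fix w assume w: "w \<in> ?W"
    then obtain x where x: "x \<in> carrier_vec k" "w = A *\<^sub>v x" using A by (auto simp: col_range_def)
    have wC: "w \<in> carrier_vec n" using w W by auto
    have "(A * Y) *\<^sub>v w = A *\<^sub>v ((Y * A) *\<^sub>v x)"
      using x A Y(1) by simp
    also have "\<dots> = c \<cdot>\<^sub>v w"
    proof -
      have "c \<cdot>\<^sub>m 1\<^sub>m k *\<^sub>v x = c \<cdot>\<^sub>v x" using x(1) by (intro eq_vecI) auto
      then show ?thesis unfolding Y(2) x(2) using mult_mat_vec[OF A x(1)] by simp
    qed
    finally have "M *\<^sub>v w + mat_trace (B * M) \<cdot>\<^sub>v w = G *\<^sub>v w + c \<cdot>\<^sub>v w + (- c) \<cdot>\<^sub>v w"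
      unfolding trM using G(1) AY wC by (simp add: M_def add_mult_distrib_mat_vec[of _ n n])
    also have "\<dots> = G *\<^sub>v w" using G(1) wC by (intro eq_vecI) auto
    finally show "g w = (\<lambda>w\<in>?W. M *\<^sub>v w + mat_trace (B * M) \<cdot>\<^sub>v w) w" using gG w by simp
  qed (use g in \<open>auto simp: hom_space_def\<close>)
  then show "g \<in> f_map n B ?W ` hom_space n (carrier_vec n) ?W"
    unfolding f_map_image[OF W B] using M R by blast
qed

section \<open>Points of the Grassmannian as column ranges\<close>

lemma (in vec_space) col_range_span:
  assumes "A \<in> carrier_mat n k"
  shows "col_range A = span (set (cols A))"
  using col_space_eq[OF assms] assms by (auto simp: col_range_def col_space_def)

text \<open>The left inverse makes \<open>A\<close> injective, so its columns are independent and
  its rank is \<open>k\<close>.\<close>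

lemma grassmannianI:
  assumes A: "A \<in> carrier_mat n k" and L: "L \<in> carrier_mat k n" and LA: "L * A = 1\<^sub>m k"
  shows "col_range A \<in> grassmannian k n"
proof -
  interpret vec_space "TYPE(complex)" n .
  have C: "set (cols A) \<subseteq> carrier_vec n" using A cols_dim by blast
  have LAx: "L *\<^sub>v (A *\<^sub>v x) = x" if "x \<in> carrier_vec k" for x
    using assoc_mult_mat_vec[OF L A that] that by (simp add: LA)
  have ccol: "col A j = A *\<^sub>v unit_vec k j" if "j < k" for j
    using A that by (intro eq_vecI) auto
  \<comment> \<open>Independence concerns the set of columns, so equal columns have to be excluded
    separately.\<close>
  have dist: "distinct (cols A)"
    unfolding distinct_conv_nth
  proof (intro allI impI)
    fix i j assume ij: "i < length (cols A)" "j < length (cols A)" "i \<noteq> j"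
    then have "i < k" "j < k" using A by auto
    have "unit_vec k i \<noteq> (unit_vec k j :: complex vec)"
      using \<open>i < k\<close> \<open>j < k\<close> ij(3) by simp
    then have "col A i \<noteq> col A j"
      using LAx[of "unit_vec k i"] LAx[of "unit_vec k j"] ccol \<open>i < k\<close> \<open>j < k\<close> by auto
    then show "cols A ! i \<noteq> cols A ! j" using ij by simp
  qed
  have "lin_indpt (set (cols A))"
  proof
    assume "lin_dep (set (cols A))"
    then obtain v where v: "v \<in> carrier_vec k" "v \<noteq> 0\<^sub>v k" "A *\<^sub>v v = 0\<^sub>v n"
      using lin_depE[OF A _ dist] by blast
    then have "v = L *\<^sub>v 0\<^sub>v n" using LAx by metis
    then show False using v(2) L by auto
  qed
  then have "rank A = k" using lin_indpt_full_rank[OF A dist] by simp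
  moreover have "VectorSpace.subspace class_ring (span (set (cols A))) V"
    using C by (intro span_is_subspace) simp
  ultimately show ?thesis
    unfolding grassmannian_def rank_def col_range_span[OF A] by simp
qed

text \<open>A basis of W is completed to a basis of V. The basis vectors of W are the columns of
  \<open>A\<close>, and the first \<open>k\<close> rows of the inverse of the full basis matrix form
  \<open>L\<close>.\<close>

lemma grassmannianE:
  assumes "W \<in> grassmannian k n"
  obtains A L where "A \<in> carrier_mat n k" "L \<in> carrier_mat k n" "L * A = 1\<^sub>m k" "W = col_range A"
proof -
  interpret vec_space "TYPE(complex)" n .
  have sub: "VectorSpace.subspace class_ring W V" and dim: "vectorspace.dim class_ring (vs W) = k"
    using assms by (auto simp: grassmannian_def)
  interpret U: vectorspace class_ring "vs W" using sub by (rule subspace_is_vs)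
  have WC: "W \<subseteq> carrier_vec n" using subspace_closed[OF sub] by blast
  have sm: "submodule class_ring W V" using sub by (simp add: subspace_def)
  note nd = span_li_not_depend[OF _ sm]
  \<comment> \<open>A basis of W is found as a maximal independent subset, which exists because
    independent sets in V have at most \<open>n\<close> elements. The facts \<open>nd\<close> carry
    span and independence between W and V.\<close>
  have "\<exists>X. finite X \<and> maximal X (\<lambda>S. S \<subseteq> W \<and> lin_indpt S)"
  proof (rule maximal_exists)
    fix S assume "S \<subseteq> W \<and> lin_indpt S"
    then show "finite S \<and> card S \<le> n"
      using li_le_dim[OF fin_dim, of S] WC dim_is_n by auto
  next
    show "{} \<subseteq> W \<and> lin_indpt {}" by (simp add: lin_dep_def)
  qed
  then obtain X where X: "finite X" "maximal X (\<lambda>S. S \<subseteq> W \<and> lin_indpt S)" by blast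
  then have XW: "X \<subseteq> W" and liX: "lin_indpt X" by (auto simp: maximal_def)
  have "maximal X (\<lambda>S. S \<subseteq> carrier (vs W) \<and> U.lin_indpt S)"
    using X(2) nd(2) unfolding maximal_def by auto
  then have "U.span X = carrier (vs W)" by (rule U.max_li_is_gen)
  then have spX: "span X = W" using nd(1)[OF XW] by simp
  have "U.basis X"
    using \<open>U.span X = carrier (vs W)\<close> nd(2)[OF XW] liX XW by (simp add: U.basis_def)
  then have cX: "card X = k" using U.dim_basis[OF X(1)] dim by simp
  have "X \<subseteq> span (set (unit_vecs n))"
    using XW WC by (simp add: span_unit_vecs_is_carrier)
  \<comment> \<open>Steinitz exchange against the unit vectors gives at most \<open>n - k\<close>
    additional vectors. As a generating set has at least \<open>n\<close> elements, equality holds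
    and \<open>X \<union> Y\<close> is a basis.\<close>
  then obtain Y where Y: "finite Y" "Y \<subseteq> carrier_vec n" "Y \<inter> X = {}"
    "int (card Y) \<le> int (card (set (unit_vecs n) :: complex vec set)) - int (card X)"
    "span (X \<union> Y) = carrier_vec n"
    using replacement[of X "set (unit_vecs n)"] X(1) liX unit_vecs_carrier[of n]
    by (auto simp: span_unit_vecs_is_carrier)
  have cn: "card (set (unit_vecs n) :: complex vec set) = n"
    using distinct_card[OF unit_vecs_distinct] by simp
  have C: "X \<union> Y \<subseteq> carrier_vec n" using XW WC Y by auto
  have cXY: "card (X \<union> Y) = k + card Y" using cX X(1) Y by (subst card_Un_disjoint) auto
  have "n \<le> k + card Y" using gen_ge_dim[of "X \<union> Y"] C X(1) Y cXY dim_is_n by simp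
  then have ck: "k + card Y = n" using Y(4) cX cn by linarith
  have "basis (X \<union> Y)" using C X(1) Y cXY ck dim_is_n by (intro dim_gen_is_basis) auto
  then have li: "lin_indpt (X \<union> Y)" by (simp add: basis_def)
  obtain xs ys where xs: "set xs = X" "distinct xs" and ys: "set ys = Y" "distinct ys"
    using finite_distinct_list X(1) Y(1) by metis
  have lxs: "length xs = k" using xs cX distinct_card by metis
  have lys: "length ys = card Y" using ys distinct_card by metis
  define P where "P = mat_of_cols n (xs @ ys)"
  have P: "P \<in> carrier_mat n n" using lxs lys ck by (auto simp: P_def)
  have cP: "cols P = xs @ ys" using C xs ys by (simp add: P_def)
  have "rank P = n"
    using xs ys Y(3) li by (intro lin_indpt_full_rank[OF P]) (auto simp: cP)
  then have "det P \<noteq> 0" using det_rank_iff[OF P] by simp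
  then obtain Q where Q: "Q \<in> carrier_mat n n" "Q * P = 1\<^sub>m n"
    using det_non_zero_imp_unit[OF P, of undefined] by (auto simp: Units_def ring_mat_def)
  define A where "A = mat_of_cols n xs"
  define L where "L = mat k n (\<lambda>(i, j). Q $$ (i, j))"
  have A: "A \<in> carrier_mat n k" using lxs by (auto simp: A_def)
  have L: "L \<in> carrier_mat k n" by (simp add: L_def)
  have kn: "k \<le> n" using ck by simp
  have cA: "cols A = xs" using C xs by (simp add: A_def)
  have colP: "col P j = col A j" if "j < k" for j
    using that cP cA lxs kn A P
    by (metis carrier_matD(2) cols_nth nth_append order.strict_trans2)
  have rowQ: "row L i = row Q i" if "i < k" for i
    using that Q(1) kn by (intro eq_vecI) (auto simp: L_def)
  have "L * A = 1\<^sub>m k"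
  proof (rule eq_matI)
    fix i j assume "i < dim_row (1\<^sub>m k :: complex mat)" "j < dim_col (1\<^sub>m k :: complex mat)"
    then have ij: "i < k" "j < k" by auto
    then have "(L * A) $$ (i, j) = (Q * P) $$ (i, j)"
      using A L P Q(1) kn by (simp add: rowQ colP)
    then show "(L * A) $$ (i, j) = 1\<^sub>m k $$ (i, j)" using Q(2) ij kn by simp
  qed (use A L in auto)
  moreover have "W = col_range A" using col_range_span[OF A] cA xs spX by simp
  ultimately show thesis using that[OF A L] by blast
qed

section \<open>The kernel of the operator on the exterior power\<close>

text \<open>\<open>alt_form\<close> states linearity only as expansion in unit vectors. Expanding
  both sides and exchanging the sums gives linearity for general combinations.\<close>

lemma alt_form_lincomb:
  assumes F: "alt_form n k F" and us: "length us = k" "set us \<subseteq> carrier_vec n" and j: "j < k"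
    and w: "w \<in> carrier_vec n" and v: "\<And>i. i \<in> S \<Longrightarrow> v i \<in> carrier_vec n"
    and eq: "\<And>m. m < n \<Longrightarrow> w $ m = (\<Sum>i\<in>S. c i * v i $ m)"
  shows "F (us[j := w]) = (\<Sum>i\<in>S. c i * F (us[j := v i]))"
proof -
  have "F (us[j := w]) = (\<Sum>m<n. (\<Sum>i\<in>S. c i * v i $ m) * F (us[j := unit_vec n m]))"
    unfolding alt_form_slot[OF F us j w] by (intro sum.cong) (auto simp: eq)
  also have "\<dots> = (\<Sum>i\<in>S. c i * (\<Sum>m<n. v i $ m * F (us[j := unit_vec n m])))"
    unfolding sum_distrib_left sum_distrib_right by (subst sum.swap) (simp add: mult_ac)
  also have "\<dots> = (\<Sum>i\<in>S. c i * F (us[j := v i]))"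
    by (intro sum.cong refl) (simp add: alt_form_slot[OF F us j v])
  finally show ?thesis .
qed

lemma mult_mat_vec_index_sum:
  fixes A :: "'a :: comm_semiring_0 mat"
  assumes "A \<in> carrier_mat n m" "x \<in> carrier_vec m" "i < n"
  shows "(A *\<^sub>v x) $ i = (\<Sum>j<m. x $ j * col A j $ i)"
  using assms by (auto simp: scalar_prod_def atLeast0LessThan mult.commute intro!: sum.cong)

text \<open>The pullback of \<open>F\<close> along \<open>L\<close>. It serves below for a left
  inverse of \<open>A\<close> and for the change to a triangularizing basis.\<close>

lemma alt_form_comp:
  assumes F: "alt_form m k F" and L: "L \<in> carrier_mat m n"
  shows "alt_form n k (\<lambda>us. F (map ((*\<^sub>v) L) us))"
proof -
  have LC: "set (map ((*\<^sub>v) L) us) \<subseteq> carrier_vec m" if "set us \<subseteq> carrier_vec n" for us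
    using that L by auto
  have cL: "L *\<^sub>v unit_vec n i = col L i" if "i < n" for i
    using L that by (intro eq_vecI) auto
  have "F (map ((*\<^sub>v) L) us) = (\<Sum>i<n. us ! j $ i * F (map ((*\<^sub>v) L) (us[j := unit_vec n i])))"
    if us: "length us = k" "set us \<subseteq> carrier_vec n" and j: "j < k" for us j
  proof -
    have uj: "us ! j \<in> carrier_vec n" using us j by auto
    have "F ((map ((*\<^sub>v) L) us)[j := L *\<^sub>v us ! j]) =
        (\<Sum>i<n. us ! j $ i * F ((map ((*\<^sub>v) L) us)[j := col L i]))"
      using us j L uj mult_mat_vec_index_sum[OF L uj]
      by (intro alt_form_lincomb[OF F _ LC]) auto
    also have "\<dots> = (\<Sum>i<n. us ! j $ i * F (map ((*\<^sub>v) L) (us[j := unit_vec n i])))"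
      by (intro sum.cong refl) (simp add: map_update cL)
    finally show ?thesis using us j by (simp flip: map_update)
  qed
  moreover have "F (map ((*\<^sub>v) L) us) = 0"
    if us: "length us = k" "set us \<subseteq> carrier_vec n"
      and ij: "i < k" "j < k" "i \<noteq> j" "us ! i = us ! j" for us i j
    using alt_formD(2)[OF F _ LC[OF us(2)] ij(1-3)] us ij by simp
  ultimately show ?thesis unfolding alt_form_def by blast
qed

lemma alt_form_sum:
  assumes F: "\<And>a. a \<in> S \<Longrightarrow> alt_form n k (F a)"
  shows "alt_form n k (\<lambda>us. \<Sum>a\<in>S. c a * F a us)"
proof -
  have "(\<Sum>a\<in>S. c a * F a us) =
      (\<Sum>m<n. us ! j $ m * (\<Sum>a\<in>S. c a * F a (us[j := unit_vec n m])))"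
    if us: "length us = k" "set us \<subseteq> carrier_vec n" "j < k" for us j
  proof -
    have "(\<Sum>a\<in>S. c a * F a us) =
        (\<Sum>a\<in>S. c a * (\<Sum>m<n. us ! j $ m * F a (us[j := unit_vec n m])))"
      using alt_formD(1)[OF F us] by (intro sum.cong) auto
    then show ?thesis
      unfolding sum_distrib_left by (subst sum.swap) (simp add: mult_ac)
  qed
  moreover have "(\<Sum>a\<in>S. c a * F a us) = 0"
    if "length us = k" "set us \<subseteq> carrier_vec n" "i < k" "j < k" "i \<noteq> j" "us ! i = us ! j" for us i j
    using alt_formD(2)[OF F that] by simp
  ultimately show ?thesis unfolding alt_form_def by blast
qed

section \<open>Vanishing of the determinant and invariant subspaces of trace
  \<open>- 1\<close>\<close>

lemma wedge_op_carrier: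
  "wedge_op k n B \<in> carrier_mat (length (index_lists k n)) (length (index_lists k n))"
  by (auto simp: wedge_op_def)

text \<open>The wedge of the columns of \<open>A\<close> is a nonzero kernel vector: applying
  \<open>B\<close> in slot \<open>j\<close> contributes only the diagonal entry of \<open>C\<close>,
  so the operator scales the wedge by \<open>1 + mat_trace C = 0\<close>.\<close>

lemma det_wedge_op_eq_0:
  assumes A: "A \<in> carrier_mat n k" and L: "L \<in> carrier_mat k n" and LA: "L * A = 1\<^sub>m k"
    and B: "B \<in> carrier_mat n n" and C: "C \<in> carrier_mat k k"
    and inv: "B * A = A * C" and tr: "mat_trace C = - 1"
  shows "det (wedge_op k n B) = 0"
proof -
  let ?us = "cols A" and ?N = "length (index_lists k n)"
  have us: "length ?us = k" "set ?us \<subseteq> carrier_vec n" using A cols_dim[of A] by auto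
  have wC: "wedge n ?us \<in> carrier_vec ?N" by (rule wedge_carrier[OF us(1)])
  have "wedge n ?us \<noteq> 0\<^sub>v ?N"
  proof
    assume z: "wedge n ?us = 0\<^sub>v ?N"
    \<comment> \<open>The list \<open>[0..<k]\<close> selects the determinant form on
      \<open>k\<close>-space. Its pullback \<open>H\<close> along \<open>L\<close> is 1 on the
      columns of \<open>A\<close>, yet by \<open>alt_form_expand\<close> it would vanish together
      with their wedge.\<close>
    have "[0..<k] \<in> set (index_lists k k)" by (auto simp: set_index_lists)
    then obtain b where b: "b < length (index_lists k k)" "index_lists k k ! b = [0..<k]"
      by (auto simp: in_set_conv_nth)
    define H where "H us = wedge k (map ((*\<^sub>v) L) us) $ b" for us
    have H: "alt_form n k H"
      unfolding H_def using alt_form_comp[OF alt_form_wedge[OF b(1)] L] .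
    have "L *\<^sub>v col A j = unit_vec k j" if "j < k" for j
      using col_mult2[OF L A that] that by (simp add: LA)
    then have "map ((*\<^sub>v) L) ?us = map (unit_vec k) (index_lists k k ! b)"
      using A by (intro nth_equalityI) (auto simp: b(2))
    then have "H ?us = 1" using wedge_basis[OF b(1) b(1)] by (simp add: H_def)
    moreover have "H ?us = 0" using alt_form_expand[OF H us] z by simp
    ultimately show False by simp
  qed
  moreover have "wedge_action n B ?us = 0\<^sub>v ?N"
  proof (rule eq_vecI)
    fix a assume "a < dim_vec (0\<^sub>v ?N :: complex vec)"
    then have a: "a < ?N" by simp
    define w where "w us = wedge n us $ a" for us
    have w: "alt_form n k w" unfolding w_def by (rule alt_form_wedge[OF a])
    have "w (?us[j := B *\<^sub>v ?us ! j]) = C $$ (j, j) * w ?us" if j: "j < k" for j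
    proof -
      have "B *\<^sub>v ?us ! j = A *\<^sub>v col C j"
        using col_mult2[OF B A j] col_mult2[OF A C j] A j by (simp add: inv)
      then have "w (?us[j := B *\<^sub>v ?us ! j]) = (\<Sum>i<k. col C j $ i * w (?us[j := col A i]))"
        using A C j mult_mat_vec_index_sum[OF A, of "col C j"]
        by (intro alt_form_lincomb[OF w us j]) auto
      \<comment> \<open>For \<open>i\<close> different from \<open>j\<close>, column
        \<open>i\<close> of \<open>A\<close> occurs in two slots and the form vanishes.\<close>
      also have "\<dots> = (\<Sum>i<k. if i = j then C $$ (j, j) * w ?us else 0)"
      proof (intro sum.cong refl)
        fix i assume "i \<in> {..<k}"
        then have i: "i < k" by simp
        have sub: "set (?us[j := col A i]) \<subseteq> carrier_vec n"
          using us A by (intro set_update) auto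
        have "?us[j := col A j] = ?us" using A j list_update_id[of ?us j] by simp
        moreover have "w (?us[j := col A i]) = 0" if "i \<noteq> j"
          using that i j us A by (intro alt_formD(2)[OF w _ sub i j]) auto
        ultimately show "col C j $ i * w (?us[j := col A i]) =
            (if i = j then C $$ (j, j) * w ?us else 0)" using C i j by auto
      qed
      finally show ?thesis using j by simp
    qed
    then have "wedge_action n B ?us $ a = w ?us + mat_trace C * w ?us"
      using wedge_action_index[OF us(1) a] C by (simp add: w_def mat_trace_def sum_distrib_right)
    then show "wedge_action n B ?us $ a = 0\<^sub>v ?N $ a" using tr a by simp
  qed (use wedge_action_carrier[OF us(1), of n B] in auto)
  ultimately show ?thesis
    using det_0_iff_vec_prod_zero_field[OF wedge_op_carrier] wC wedge_op_wedge[OF B us] by metis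
qed

text \<open>A left kernel vector \<open>y\<close> is a functional on the exterior power. Composed
  with \<open>wedge\<close> it is an alternating form, and being annihilated by the operator is the
  stated identity. \<open>I\<close> belongs to a nonzero coordinate of \<open>y\<close>.\<close>

lemma det_wedge_op_form:
  assumes B: "B \<in> carrier_mat n n" and det: "det (wedge_op k n B) = 0"
  obtains F I where "alt_form n k F" "length I = k" "set I \<subseteq> {..<n}" "F (map (unit_vec n) I) \<noteq> 0"
    "\<And>us. length us = k \<Longrightarrow> set us \<subseteq> carrier_vec n \<Longrightarrow>
      F us + (\<Sum>j<k. F (us[j := B *\<^sub>v us ! j])) = 0"
proof -
  let ?N = "length (index_lists k n)" and ?M = "wedge_op k n B"
  have M: "?M \<in> carrier_mat ?N ?N" by (rule wedge_op_carrier)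
  have "det (?M\<^sup>T) = 0" using det det_transpose[OF M] by simp
  then obtain y where y: "y \<in> carrier_vec ?N" "y \<noteq> 0\<^sub>v ?N" "?M\<^sup>T *\<^sub>v y = 0\<^sub>v ?N"
    using det_0_iff_vec_prod_zero_field[of "?M\<^sup>T" ?N] M by auto
  define F where "F us = (\<Sum>a<?N. y $ a * wedge n us $ a)" for us
  have F: "alt_form n k F"
    unfolding F_def using alt_form_wedge by (intro alt_form_sum) auto
  obtain a where a: "a < ?N" "y $ a \<noteq> 0" using y(1,2) by (metis carrier_vecD eq_vecI index_zero_vec)
  define I where "I = index_lists k n ! a"
  have "I \<in> set (index_lists k n)" using a by (simp add: I_def)
  then have I: "length I = k" "set I \<subseteq> {..<n}" by (auto simp: set_index_lists)
  have "F (map (unit_vec n) I) = (\<Sum>b<?N. if b = a then y $ b else 0)"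
    unfolding F_def using wedge_basis[of _ k n a] a(1) by (intro sum.cong) (auto simp: I_def)
  then have FI: "F (map (unit_vec n) I) \<noteq> 0" using a by simp
  have "F us + (\<Sum>j<k. F (us[j := B *\<^sub>v us ! j])) = 0"
    if us: "length us = k" "set us \<subseteq> carrier_vec n" for us
  proof -
    have wC: "wedge n us \<in> carrier_vec ?N" by (rule wedge_carrier[OF us(1)])
    have "(\<Sum>j<k. F (us[j := B *\<^sub>v us ! j])) =
        (\<Sum>a<?N. y $ a * (\<Sum>j<k. wedge n (us[j := B *\<^sub>v us ! j]) $ a))"
      unfolding F_def sum_distrib_left by (rule sum.swap)
    then have "F us + (\<Sum>j<k. F (us[j := B *\<^sub>v us ! j])) =
        (\<Sum>a<?N. y $ a * wedge_action n B us $ a)"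
      using us(1) by (simp add: F_def wedge_action_index distrib_left sum.distrib)
    also have "\<dots> = y \<bullet> (?M *\<^sub>v wedge n us)"
      using wedge_action_carrier[OF us(1), of n B]
      by (simp add: wedge_op_wedge[OF B us] scalar_prod_def atLeast0LessThan)
    also have "\<dots> = (?M\<^sup>T *\<^sub>v y) \<bullet> wedge n us"
      using transpose_vec_mult_scalar[OF M wC y(1)] by simp
    also have "\<dots> = 0" using wC by (simp add: y(3))
    finally show ?thesis .
  qed
  then show thesis using that[OF F I FI] by blast
qed

text \<open>Choose columns of \<open>P\<close> on which the form is nonzero, with least index sum.
  By triangularity, \<open>B\<close> sends each column to its eigenvalue multiple plus earlier
  columns, and by minimality these contribute nothing. The kernel identity becomes one plus the
  eigenvalue sum, times a nonzero number.\<close>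

lemma eigenvalue_sum:
  assumes B: "B \<in> carrier_mat n n" and det: "det (wedge_op k n B) = 0"
    and sim: "similar_mat_wit B T P Q" and ut: "upper_triangular T"
  obtains gs where "length gs = k" "distinct gs" "set gs \<subseteq> {..<n}"
    "(\<Sum>i\<leftarrow>gs. T $$ (i, i)) = - 1"
proof -
  note S = similar_mat_witD2[OF B sim]
  have T: "T \<in> carrier_mat n n" and P: "P \<in> carrier_mat n n" and Q: "Q \<in> carrier_mat n n"
    using S by auto
  have PQ: "P * Q = 1\<^sub>m n" and QP: "Q * P = 1\<^sub>m n" using S by auto
  have BP: "B * P = P * T"
    using S(3) P Q T QP by (simp add: assoc_mult_mat[of _ n n _ n _ n])
  obtain F I where F: "alt_form n k F" and I: "length I = k" "set I \<subseteq> {..<n}"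
    and FI: "F (map (unit_vec n) I) \<noteq> 0"
    and zero: "\<And>us. length us = k \<Longrightarrow> set us \<subseteq> carrier_vec n \<Longrightarrow>
      F us + (\<Sum>j<k. F (us[j := B *\<^sub>v us ! j])) = 0"
    using det_wedge_op_form[OF B det] by metis
  define p where "p gs = map (col P) gs" for gs
  have pC: "set (p gs) \<subseteq> carrier_vec n" for gs using P by (auto simp: p_def)
  define G where "G = (\<lambda>gs. length gs = k \<and> set gs \<subseteq> {..<n} \<and> F (p gs) \<noteq> 0)"
  have "\<exists>gs. G gs"
  proof (rule ccontr)
    assume no: "\<nexists>gs. G gs"
    \<comment> \<open>If the form vanished on all tuples of columns of \<open>P\<close>, its
      pullback along \<open>P\<close> would be zero. On the columns of \<open>Q\<close> indexed by
      \<open>I\<close>, however, the pullback is the nonzero value \<open>FI\<close>.\<close>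
    have FP: "alt_form n k (\<lambda>us. F (map ((*\<^sub>v) P) us))" using alt_form_comp[OF F P] .
    have "F (map ((*\<^sub>v) P) (map (unit_vec n) J)) = 0" if "J \<in> set (index_lists k n)" for J
    proof -
      have J: "length J = k" "set J \<subseteq> {..<n}" using that by (auto simp: set_index_lists)
      have "P *\<^sub>v unit_vec n i = col P i" if "i < n" for i
        using P that by (intro eq_vecI) auto
      then have "map ((*\<^sub>v) P) (map (unit_vec n) J) = p J" using J(2) by (auto simp: p_def)
      then show ?thesis using no J by (auto simp: G_def)
    qed
    moreover have "set (map (col Q) I) \<subseteq> carrier_vec n" using Q by auto
    ultimately have "F (map ((*\<^sub>v) P) (map (col Q) I)) = 0"
      using alt_form_zero[OF FP] I(1) by (metis length_map)
    moreover have "P *\<^sub>v col Q i = unit_vec n i" if "i < n" for i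
      using col_mult2[OF P Q that] that by (simp add: PQ)
    then have "map ((*\<^sub>v) P) (map (col Q) I) = map (unit_vec n) I" using I(2) by auto
    ultimately show False using FI by metis
  qed
  then obtain gs where gs: "G gs" and min: "\<And>hs. G hs \<Longrightarrow> sum_list gs \<le> sum_list hs"
    using ex_has_least_nat[of G _ sum_list] by metis
  then have lg: "length gs = k" and sg: "set gs \<subseteq> {..<n}" and Fg: "F (p gs) \<noteq> 0"
    by (auto simp: G_def)
  have lp: "length (p gs) = k" using lg by (simp add: p_def)
  have gn: "gs ! j < n" if "j < k" for j using sg lg that nth_mem[of j gs] by (metis lessThan_iff subsetD)
  have "distinct gs"
    unfolding distinct_conv_nth
  proof (intro allI impI)
    fix i j assume ij: "i < length gs" "j < length gs" "i \<noteq> j"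
    then show "gs ! i \<noteq> gs ! j"
      using alt_formD(2)[OF F lp pC, of i j] Fg lg by (auto simp: p_def)
  qed
  have "F ((p gs)[j := B *\<^sub>v p gs ! j]) = T $$ (gs ! j, gs ! j) * F (p gs)" if j: "j < k" for j
  proof -
    let ?g = "gs ! j"
    have "B *\<^sub>v p gs ! j = P *\<^sub>v col T ?g"
      using col_mult2[OF B P gn[OF j]] col_mult2[OF P T gn[OF j]] j lg by (simp add: BP p_def)
    then have "F ((p gs)[j := B *\<^sub>v p gs ! j]) =
        (\<Sum>i<n. col T ?g $ i * F ((p gs)[j := col P i]))"
      using P T gn[OF j] mult_mat_vec_index_sum[OF P, of "col T ?g"]
      by (intro alt_form_lincomb[OF F lp pC j]) auto
    also have "\<dots> = (\<Sum>i<n. if i = ?g then T $$ (?g, ?g) * F (p gs) else 0)"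
    proof (intro sum.cong refl)
      fix i assume "i \<in> {..<n}"
      then have i: "i < n" by simp
      have pi: "(p gs)[j := col P i] = p (gs[j := i])" by (simp add: p_def map_update)
      consider "i < ?g" | "i = ?g" | "?g < i" by linarith
      then show "col T ?g $ i * F ((p gs)[j := col P i]) =
          (if i = ?g then T $$ (?g, ?g) * F (p gs) else 0)"
      proof cases
        case 1
        have "sum_list (gs[j := i]) < sum_list gs"
          using 1 j lg elem_le_sum_list[of j gs] by (simp add: sum_list_update)
        then have "\<not> G (gs[j := i])" using min by (metis not_le)
        then have "F (p (gs[j := i])) = 0"
          using lg set_update[OF sg, of i j] i by (auto simp: G_def)
        then show ?thesis using 1 by (simp add: pi)
      next
        case 2
        then show ?thesis using T gn[OF j] pi by simp
      next
        case 3
        then have "T $$ (i, ?g) = 0" using ut T i by auto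
        then show ?thesis using T i gn[OF j] 3 by simp
      qed
    qed
    finally show ?thesis using gn[OF j] by simp
  qed
  then have "(1 + (\<Sum>j<k. T $$ (gs ! j, gs ! j))) * F (p gs) = 0"
    using zero[OF lp pC] by (simp add: distrib_right sum_distrib_right)
  then have "1 + (\<Sum>j<k. T $$ (gs ! j, gs ! j)) = 0" using Fg by simp
  moreover have "(\<Sum>i\<leftarrow>gs. T $$ (i, i)) = (\<Sum>j<k. T $$ (gs ! j, gs ! j))"
    using lg by (simp add: sum_list_sum_nth atLeast0LessThan)
  ultimately have "(\<Sum>i\<leftarrow>gs. T $$ (i, i)) = - 1" by (simp add: eq_neg_iff_add_eq_0 add.commute)
  then show thesis using that lg \<open>distinct gs\<close> sg by blast
qed

text \<open>The characteristic polynomial depends only on the multiset of its roots, so the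
  \<open>k\<close> eigenvalues with sum \<open>- 1\<close> can be listed first. They come from
  distinct diagonal positions, which respects multiplicities and gives
  \<open>k \<le> n\<close>.\<close>

lemma char_poly_sum:
  assumes B: "B \<in> carrier_mat n n" and det: "det (wedge_op k n B) = 0"
  obtains es where "char_poly B = (\<Prod>e\<leftarrow>es. [:- e, 1:])" "length es = n" "k \<le> n"
    "sum_list (take k es) = - 1"
proof -
  obtain as where as: "char_poly B = (\<Prod>a\<leftarrow>as. [:- a, 1:])" "length as = n"
    using char_poly_factorized[OF B] by blast
  obtain T P Q where TPQ: "schur_decomposition B as = (T, P, Q)" by (metis prod_cases3)
  note S = schur_decomposition[OF B as(1) TPQ]
  have T: "T \<in> carrier_mat n n" using similar_mat_witD2[OF B, of T P Q] S by auto
  obtain gs where gs: "length gs = k" "distinct gs" "set gs \<subseteq> {..<n}"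
    "(\<Sum>i\<leftarrow>gs. T $$ (i, i)) = - 1"
    using eigenvalue_sum[OF B det] S by blast
  define js where "js = filter (\<lambda>i. i \<notin> set gs) [0..<n]"
  define es where "es = map (\<lambda>i. T $$ (i, i)) (gs @ js)"
  have "mset (gs @ js) = mset [0..<n]"
    using gs(2,3) by (intro set_eq_iff_mset_eq_distinct[THEN iffD1]) (auto simp: js_def)
  moreover have "as = map (\<lambda>i. T $$ (i, i)) [0..<n]" using S T by (auto simp: diag_mat_def)
  ultimately have ms: "mset es = mset as" by (simp only: es_def mset_map)
  then have "mset (map (\<lambda>e. [:- e, 1:]) es) = mset (map (\<lambda>e. [:- e, 1:]) as)" by simp
  then have "(\<Prod>e\<leftarrow>es. [:- e, 1:]) = (\<Prod>e\<leftarrow>as. [:- e, 1:])" by (metis prod_mset_prod_list)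
  moreover have "length es = n" using ms as(2) by (metis size_mset)
  moreover have "k \<le> n" using gs distinct_card[of gs] card_mono[of "{..<n}" "set gs"] by simp
  moreover have "sum_list (take k es) = - 1" using gs by (simp add: es_def)
  ultimately show thesis using that[of es] as(1) by metis
qed

text \<open>A Schur decomposition realizes the prescribed eigenvalue order on the diagonal. The
  first \<open>k\<close> columns of \<open>P\<close> then span an invariant subspace, on which
  \<open>B\<close> acts by the leading block \<open>C\<close> of \<open>T\<close>.\<close>

lemma det_wedge_op_eq_0D:
  assumes B: "B \<in> carrier_mat n n" and det: "det (wedge_op k n B) = 0"
  obtains A L C where "A \<in> carrier_mat n k" "L \<in> carrier_mat k n" "C \<in> carrier_mat k k"
    "L * A = 1\<^sub>m k" "B * A = A * C" "mat_trace C = - 1"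
proof -
  obtain es where es: "char_poly B = (\<Prod>e\<leftarrow>es. [:- e, 1:])" "length es = n" and kn: "k \<le> n"
    and tr: "sum_list (take k es) = - 1"
    using char_poly_sum[OF B det] by blast
  obtain T P Q where TPQ: "schur_decomposition B es = (T, P, Q)" by (metis prod_cases3)
  note S = schur_decomposition[OF B es(1) TPQ]
  then have sim: "similar_mat_wit B T P Q" and ut: "upper_triangular T" and di: "diag_mat T = es"
    by auto
  note S = similar_mat_witD2[OF B sim]
  have T: "T \<in> carrier_mat n n" and P: "P \<in> carrier_mat n n" and Q: "Q \<in> carrier_mat n n"
    and QP: "Q * P = 1\<^sub>m n" using S by auto
  have BP: "B * P = P * T"
    using S(3) P Q T QP by (simp add: assoc_mult_mat[of _ n n _ n _ n])
  define A where "A = mat n k (\<lambda>(i, j). P $$ (i, j))"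
  define L where "L = mat k n (\<lambda>(i, j). Q $$ (i, j))"
  define C where "C = mat k k (\<lambda>(i, j). T $$ (i, j))"
  have A: "A \<in> carrier_mat n k" and L: "L \<in> carrier_mat k n" and C: "C \<in> carrier_mat k k"
    by (simp_all add: A_def L_def C_def)
  have colA: "col A j = col P j" if "j < k" for j
    using that P kn by (intro eq_vecI) (auto simp: A_def)
  have rowL: "row L i = row Q i" if "i < k" for i
    using that Q kn by (intro eq_vecI) (auto simp: L_def)
  have "L * A = 1\<^sub>m k"
  proof (rule eq_matI)
    fix i j assume "i < dim_row (1\<^sub>m k :: complex mat)" "j < dim_col (1\<^sub>m k :: complex mat)"
    then have ij: "i < k" "j < k" by auto
    then have "(L * A) $$ (i, j) = (Q * P) $$ (i, j)"
      using A L P Q kn by (simp add: rowL colA)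
    then show "(L * A) $$ (i, j) = 1\<^sub>m k $$ (i, j)" using QP ij kn by simp
  qed (use A L in auto)
  moreover have "B * A = A * C"
  proof (rule eq_matI)
    fix i j assume "i < dim_row (A * C)" "j < dim_col (A * C)"
    then have ij: "i < n" "j < k" using A C by auto
    have "(B * A) $$ (i, j) = (P * T) $$ (i, j)"
      using ij A B P kn by (simp add: colA flip: BP)
    also have "\<dots> = (\<Sum>m<n. P $$ (i, m) * T $$ (m, j))"
      using ij P T kn by (simp add: scalar_prod_def atLeast0LessThan)
    \<comment> \<open>Terms with \<open>m \<ge> k > j\<close> involve entries of \<open>T\<close>
      below the diagonal.\<close>
    also have "\<dots> = (\<Sum>m<k. P $$ (i, m) * T $$ (m, j))"
      using ij upper_triangularD[OF ut] T kn by (intro sum.mono_neutral_right) auto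
    also have "\<dots> = (A * C) $$ (i, j)"
      using ij by (simp add: scalar_prod_def atLeast0LessThan A_def C_def)
    finally show "(B * A) $$ (i, j) = (A * C) $$ (i, j)" .
  qed (use A B C in auto)
  moreover have "mat_trace C = sum_list (take k es)"
    using kn T by (simp add: mat_trace_def C_def di[symmetric] diag_mat_def take_map
        sum_list_sum_nth atLeast0LessThan)
  ultimately show thesis using that[OF A L C] tr by simp
qed

theorem theorem3p4:
  fixes n k :: nat
  assumes "1 \<le> k" and "k < n - 1"
  shows "degenerate_locus k n = {B \<in> carrier_mat n n. det (wedge_op k n B) = 0}"
proof (intro equalityI subsetI)
  fix B assume "B \<in> degenerate_locus k n"
  then obtain W where B: "B \<in> carrier_mat n n" and W: "W \<in> grassmannian k n"
    and ns: "\<not> hom_space n W W \<subseteq> f_map n B W ` hom_space n (carrier_vec n) W"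
    by (auto simp: degenerate_locus_def)
  obtain A L where A: "A \<in> carrier_mat n k" and L: "L \<in> carrier_mat k n"
    and LA: "L * A = 1\<^sub>m k" and WA: "W = col_range A"
    using grassmannianE[OF W] by metis
  \<comment> \<open>\<open>L * B * A\<close> is the matrix of \<open>B\<close> on W in the basis of
    columns of \<open>A\<close>, once W is invariant.\<close>
  have "B * A = A * (L * B * A)" "mat_trace (L * B * A) = - 1"
    using f_map_surj[OF A L LA B] ns WA by auto
  then have "det (wedge_op k n B) = 0"
    using A B L by (intro det_wedge_op_eq_0[OF A L LA B, of "L * B * A"]) auto
  then show "B \<in> {B \<in> carrier_mat n n. det (wedge_op k n B) = 0}" using B by simp
next
  fix B assume "B \<in> {B \<in> carrier_mat n n. det (wedge_op k n B) = 0}"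
  then have B: "B \<in> carrier_mat n n" and det: "det (wedge_op k n B) = 0" by auto
  obtain A L C where A: "A \<in> carrier_mat n k" and L: "L \<in> carrier_mat k n"
    and C: "C \<in> carrier_mat k k" and LA: "L * A = 1\<^sub>m k"
    and BA: "B * A = A * C" and tr: "mat_trace C = - 1"
    using det_wedge_op_eq_0D[OF B det] by metis
  have "L * B * A = L * (A * C)" using assoc_mult_mat[OF L B A] BA by simp
  also have "\<dots> = C" using assoc_mult_mat[OF L A C] LA C by simp
  finally have "L * B * A = C" .
  then have "\<not> hom_space n (col_range A) (col_range A)
      \<subseteq> f_map n B (col_range A) ` hom_space n (carrier_vec n) (col_range A)"
    using f_map_not_surj[OF A L LA B] BA tr by simp
  then show "B \<in> degenerate_locus k n"
    using B grassmannianI[OF A L LA] by (auto simp: degenerate_locus_def)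
qed

end
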